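(* Suppose there are constants, independent of the mesh size $h$ and of how the surface cuts the background mesh, such that the following hold: (i) $A_h$ is continuous: $A_h(w,v)\lesssim\|w\|_{A_h}\|v\|_{A_h}$ for all $v,w\in V_h^p+H^{p+1}(\mathcal T_h)$; (ii) $A_h$ is coercive: $\|v\|_{A_h}^2\lesssim A_h(v,v)$ for all $v\in V_h^p$; (iii) inverse inequality: $\|v\|_{A_h}\lesssim h^{-3/2}\|v\|_{L^2(\mathcal T_h)}$ for all $v\in V_h^p$; (iv) Poincaré inequality: $\|v\|_{L^2(\mathcal T_h)}\lesssim h^{1/2}\|v\|_{A_h}$ for all $v\in V_h^p$. Then the spectral condition number of the stiffness matrix $\mathcal A_h$ associated with $A_h$ satisfies $$\kappa(\mathcal A_h)\lesssim h^{-2}.$$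
   Context: Convention: $X\lesssim Y$ means $X\le CY$ with $C$ independent of $h\in(0,h_0]$, of the functions involved, and of how $\Gamma_h$ cuts the background mesh. $\Omega\subset\mathbb R^3$ is a polygonal domain, $\mathcal T_{h,0}$ a quasi-uniform partition of $\Omega$ into shape regular tetrahedra with mesh parameter $h\in(0,h_0]$, and $V_{h,0}^p$ the space of continuous piecewise polynomials of degree $p\ge1$ on it. $\Gamma_h\subset\Omega$ is a closed discrete surface (approximating a smooth closed surface $\Gamma$) with unit normal $n_h$; $\mathcal T_h$ is the set of elements of $\mathcal T_{h,0}$ cut by $\Gamma_h$ (also the union of these elements). $V_h^p=\{v\in V_{h,0}^p|_{\mathcal T_h}:\int_{\Gamma_h}v\,ds_h=0\}$. $\nabla_{\Gamma_h}v=(I-n_h\otimes n_h)\nabla v$, $a_h(w,v)=\int_{\Gamma_h}\nabla_{\Gamma_h}w\cdot\nabla_{\Gamma_h}v\,ds_h$, $s_h$ is a symmetric positive semidefinite bilinear form on $V_h^p+H^{p+1}(\mathcal T_h)$ (the stabilization form), $A_h=a_h+s_h$, and $\|v\|_{A_h}^2=a_h(v,v)+s_h(v,v)$. Let $\{\varphi_i\}_{i=1}^N$ be the Lagrange (nodal) basis of $V_{h,0}^p|_{\mathcal T_h}$; each $v\in V_h^p$ is written $v=\sum_i\widehat v_i\varphi_i$, with coefficient vector $\widehat v$ in $\widehat{\mathbb R}^N=\{\widehat v\in\mathbb R^N:\sum_i\widehat v_i\int_{\Gamma_h}\varphi_i\,ds_h=0\}$. The stiffness matrix $\mathcal A_h$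 is the symmetric operator on $\widehat{\mathbb R}^N$ (with the Euclidean inner product) defined by $(\mathcal A_h\widehat w,\widehat v)=A_h(w,v)$ for all $v,w\in V_h^p$. Its spectral condition number $\kappa(\mathcal A_h)$ is the ratio of its largest to its smallest eigenvalue, i.e. the ratio of the maximum to the minimum of $(\mathcal A_h\widehat u,\widehat u)$ over $\widehat u\in\widehat{\mathbb R}^N$ with Euclidean norm $1$. *)

theory Defs
  imports "HOL-Analysis.Analysis" "Jordan_Normal_Form.Matrix"
begin

type_synonym pt = "real ^ 3"
type_synonym scalar_fun = "pt \<Rightarrow> real"


section \<open>Domain and background mesh\<close>

definition polyhedral_domain :: "pt set \<Rightarrow> bool" where
  "polyhedral_domain \<Omega> \<longleftrightarrow> \<Omega> \<noteq> {} \<and> connected \<Omega> \<and>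
     (\<exists>F. finite F \<and> (\<forall>P\<in>F. polytope P) \<and> \<Omega> = interior (\<Union>F))"

text \<open>Conforming: \<^const>\<open>triangulation\<close> demands that two elements meet in a common face.\<close>

definition tetrahedral_partition :: "pt set \<Rightarrow> pt set set \<Rightarrow> bool" where
  "tetrahedral_partition \<Omega> \<T> \<longleftrightarrow>
     triangulation \<T> \<and> (\<forall>T\<in>\<T>. 3 simplex T) \<and> \<Union>\<T> = closure \<Omega>"

definition quasi_uniform :: "real \<Rightarrow> real \<Rightarrow> pt set set \<Rightarrow> bool" where
  "quasi_uniform c h \<T> \<longleftrightarrow> (\<forall>T\<in>\<T>. diameter T \<le> c * h \<and> h \<le> c * diameter T)"

definition inradius :: "pt set \<Rightarrow> real" where
  "inradius T = Sup {r. \<exists>x. cball x r \<subseteq> T}"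

definition shape_regular :: "real \<Rightarrow> pt set set \<Rightarrow> bool" where
  "shape_regular c \<T> \<longleftrightarrow> (\<forall>T\<in>\<T>. diameter T \<le> c * inradius T)"


section \<open>Surfaces in space\<close>

text \<open>The two-dimensional Hausdorff measure, normalised by \<open>pi / 4\<close> so that it is surface
  area. The boundedness condition is needed because \<^const>\<open>diameter\<close> is a real number.\<close>

definition hausdorff2_outer :: "pt set \<Rightarrow> ennreal" where
  "hausdorff2_outer A =
     (SUP \<delta>\<in>{0<..}. INF E\<in>{E :: nat \<Rightarrow> pt set.
          A \<subseteq> (\<Union>i. E i) \<and> (\<forall>i. bounded (E i) \<and> diameter (E i) \<le> \<delta>)}.
        (\<Sum>i. ennreal (pi / 4 * (diameter (E i))\<^sup>2)))"

definition surface_measure :: "pt measure" where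
  "surface_measure = measure_of UNIV (sets borel) hausdorff2_outer"

definition surface_chart :: "pt set \<Rightarrow> (real ^ 2) set \<Rightarrow> (real ^ 2 \<Rightarrow> pt) \<Rightarrow> bool" where
  "surface_chart \<Gamma> V f \<longleftrightarrow> open V \<and> openin (top_of_set \<Gamma>) (f ` V) \<and>
     (\<exists>L>0. \<forall>y\<in>V. \<forall>z\<in>V. dist y z \<le> L * dist (f y) (f z) \<and> dist (f y) (f z) \<le> L * dist y z)"

text \<open>Compact surface without boundary. Only Lipschitz regularity is asked for, since a
  discrete surface is in general just piecewise smooth.\<close>

definition closed_surface :: "pt set \<Rightarrow> bool" where
  "closed_surface \<Gamma> \<longleftrightarrow> compact \<Gamma> \<and> \<Gamma> \<noteq> {} \<and>
     (\<forall>x\<in>\<Gamma>. \<exists>V f. surface_chart \<Gamma> V f \<and> x \<in> f ` V)"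

text \<open>The tangent plane, hence the unit normal, is determined almost everywhere (Rademacher).\<close>

definition unit_normal_field :: "pt set \<Rightarrow> (pt \<Rightarrow> pt) \<Rightarrow> bool" where
  "unit_normal_field \<Gamma> n \<longleftrightarrow>
     n \<in> borel_measurable (restrict_space borel \<Gamma>) \<and> (\<forall>x\<in>\<Gamma>. norm (n x) = 1) \<and>
     (\<forall>V f. surface_chart \<Gamma> V f \<longrightarrow>
        (AE y in lebesgue. y \<in> V \<longrightarrow>
           (\<forall>D. (f has_derivative D) (at y) \<longrightarrow> (\<forall>e. inner (n (f y)) (D e) = 0))))"


section \<open>Weak derivatives and Sobolev spaces\<close>

definition partial :: "3 \<Rightarrow> scalar_fun \<Rightarrow> scalar_fun" where
  "partial i f = (\<lambda>x. frechet_derivative f (at x) (axis i 1))"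

text \<open>Multi-indices are encoded as lists of coordinate directions.\<close>

primrec iter_partial :: "3 list \<Rightarrow> scalar_fun \<Rightarrow> scalar_fun" where
  "iter_partial [] f = f"
| "iter_partial (j # js) f = partial j (iter_partial js f)"

definition smooth :: "scalar_fun \<Rightarrow> bool" where
  "smooth f \<longleftrightarrow> (\<forall>js x. iter_partial js f differentiable (at x))"

definition test_functions :: "pt set \<Rightarrow> scalar_fun set" where
  "test_functions U = {\<psi>. smooth \<psi> \<and> compact (closure {x. \<psi> x \<noteq> 0}) \<and> closure {x. \<psi> x \<noteq> 0} \<subseteq> U}"

definition locally_integrable :: "pt set \<Rightarrow> scalar_fun \<Rightarrow> bool" where
  "locally_integrable U f \<longleftrightarrow> (\<forall>K. compact K \<and> K \<subseteq> U \<longrightarrow> set_integrable lebesgue K f)"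

definition weak_deriv :: "pt set \<Rightarrow> 3 list \<Rightarrow> scalar_fun \<Rightarrow> scalar_fun \<Rightarrow> bool" where
  "weak_deriv U js u g \<longleftrightarrow> locally_integrable U u \<and> locally_integrable U g \<and>
     (\<forall>\<psi>\<in>test_functions U.
        (LINT x:U|lebesgue. u x * iter_partial js \<psi> x)
        = (- 1) ^ length js * (LINT x:U|lebesgue. g x * \<psi> x))"

definition square_integrable :: "pt set \<Rightarrow> scalar_fun \<Rightarrow> bool" where
  "square_integrable U f \<longleftrightarrow>
     set_borel_measurable lebesgue U f \<and> set_integrable lebesgue U (\<lambda>x. (f x)\<^sup>2)"

text \<open>Elements are represented by functions on the whole space whose values outside \<open>U\<close> (and on
  null sets) are immaterial.\<close>

definition sobolev :: "nat \<Rightarrow> pt set \<Rightarrow> scalar_fun set" where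
  "sobolev k U = {u. square_integrable U u \<and>
     (\<forall>js. length js \<le> k \<longrightarrow> (\<exists>g. square_integrable U g \<and> weak_deriv U js u g))}"

definition weak_gradient :: "pt set \<Rightarrow> scalar_fun \<Rightarrow> pt \<Rightarrow> pt" where
  "weak_gradient U u = (SOME g. \<forall>i. weak_deriv U [i] u (\<lambda>x. g x $ i))"

text \<open>The limit of averages over shrinking balls. For functions in \<open>H^1\<close> it exists up to a
  set of vanishing surface measure and is the trace on surfaces inside the open set. For a
  piecewise polynomial it gives, on a face of the mesh, the mean of the two one-sided
  values.\<close>

definition precise_representative :: "scalar_fun \<Rightarrow> scalar_fun" where
  "precise_representative g x =
     Lim (at_right 0) (\<lambda>r. (LINT y:ball x r|lebesgue. g y) / measure lebesgue (ball x r))"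

definition gradient_trace :: "pt set \<Rightarrow> scalar_fun \<Rightarrow> pt \<Rightarrow> pt" where
  "gradient_trace U u x = (\<chi> i. precise_representative (\<lambda>y. weak_gradient U u y $ i) x)"


section \<open>Finite element spaces\<close>

definition polynomials :: "nat \<Rightarrow> scalar_fun set" where
  "polynomials p = {q. \<exists>c :: (3 \<Rightarrow> nat) \<Rightarrow> real.
     \<forall>x. q x = (\<Sum>\<alpha> | sum \<alpha> UNIV \<le> p. c \<alpha> * (\<Prod>i\<in>UNIV. (x $ i) ^ \<alpha> i))}"

definition fe_space :: "nat \<Rightarrow> pt set set \<Rightarrow> scalar_fun set" where
  "fe_space p \<T> = {v. continuous_on (\<Union>\<T>) v \<and>
     (\<forall>T\<in>\<T>. \<exists>q\<in>polynomials p. \<forall>x\<in>T. v x = q x)}"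

definition lagrange_nodes :: "nat \<Rightarrow> pt set \<Rightarrow> pt set" where
  "lagrange_nodes p T = {x. \<exists>k :: pt \<Rightarrow> nat. (\<Sum>a | a extreme_point_of T. k a) = p \<and>
     x = (\<Sum>a | a extreme_point_of T. (real (k a) / real p) *\<^sub>R a)}"


section \<open>The cut finite element discretization\<close>

record discretization =
  meshsize :: real
  bgmesh :: "pt set set"
  dsurface :: "pt set"
  dnormal :: "pt \<Rightarrow> pt"
  stab :: "scalar_fun \<Rightarrow> scalar_fun \<Rightarrow> real"

definition active_mesh :: "discretization \<Rightarrow> pt set set" where
  "active_mesh D = {T \<in> bgmesh D. T \<inter> dsurface D \<noteq> {}}"

definition active_domain :: "discretization \<Rightarrow> pt set" where
  "active_domain D = \<Union>(active_mesh D)"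

definition surface_integral :: "discretization \<Rightarrow> scalar_fun \<Rightarrow> real" where
  "surface_integral D f = (LINT x:dsurface D|surface_measure. f x)"

text \<open>Restrictions to the active domain are extended by zero, so that equal restrictions are
  equal functions.\<close>

definition active_fe_space :: "nat \<Rightarrow> discretization \<Rightarrow> scalar_fun set" where
  "active_fe_space p D =
     (\<lambda>v x. if x \<in> active_domain D then v x else 0) ` fe_space p (bgmesh D)"

definition Vh :: "nat \<Rightarrow> discretization \<Rightarrow> scalar_fun set" where
  "Vh p D = {v \<in> active_fe_space p D. surface_integral D v = 0}"

definition Vh_plus_H :: "nat \<Rightarrow> discretization \<Rightarrow> scalar_fun set" where
  "Vh_plus_H p D = {\<lambda>x. v x + w x | v w. v \<in> Vh p D \<and> w \<in> sobolev (p + 1) (interior (active_domain D))}"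

definition tangential_gradient :: "discretization \<Rightarrow> scalar_fun \<Rightarrow> pt \<Rightarrow> pt" where
  "tangential_gradient D u x =
     (let g = gradient_trace (interior (active_domain D)) u x; n = dnormal D x
      in g - inner n g *\<^sub>R n)"

definition a_form :: "discretization \<Rightarrow> scalar_fun \<Rightarrow> scalar_fun \<Rightarrow> real" where
  "a_form D w v =
     surface_integral D (\<lambda>x. inner (tangential_gradient D w x) (tangential_gradient D v x))"

definition A_form :: "discretization \<Rightarrow> scalar_fun \<Rightarrow> scalar_fun \<Rightarrow> real" where
  "A_form D w v = a_form D w v + stab D w v"

definition energy_norm :: "discretization \<Rightarrow> scalar_fun \<Rightarrow> real" where
  "energy_norm D v = sqrt (a_form D v v + stab D v v)"

definition L2_norm_active :: "discretization \<Rightarrow> scalar_fun \<Rightarrow> real" where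
  "L2_norm_active D v = sqrt (LINT x:active_domain D|lebesgue. (v x)\<^sup>2)"

text \<open>The last condition makes the form well defined on classes of functions that agree almost
  everywhere on the active domain.\<close>

definition stabilization_form :: "nat \<Rightarrow> discretization \<Rightarrow> bool" where
  "stabilization_form p D \<longleftrightarrow>
     (\<forall>u\<in>Vh_plus_H p D. \<forall>v\<in>Vh_plus_H p D. \<forall>w\<in>Vh_plus_H p D. \<forall>c.
        stab D (\<lambda>x. u x + v x) w = stab D u w + stab D v w \<and>
        stab D (\<lambda>x. c * u x) w = c * stab D u w) \<and>
     (\<forall>u\<in>Vh_plus_H p D. \<forall>v\<in>Vh_plus_H p D. stab D u v = stab D v u) \<and>
     (\<forall>u\<in>Vh_plus_H p D. 0 \<le> stab D u u) \<and>
     (\<forall>u\<in>Vh_plus_H p D. \<forall>v\<in>Vh_plus_H p D. \<forall>w\<in>Vh_plus_H p D.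
        (AE x in lebesgue. x \<in> active_domain D \<longrightarrow> u x = v x) \<longrightarrow> stab D u w = stab D v w)"

definition discretization_family ::
    "pt set \<Rightarrow> nat \<Rightarrow> real \<Rightarrow> discretization set \<Rightarrow> bool" where
  "discretization_family \<Omega> p h0 \<D> \<longleftrightarrow>
     (\<forall>D\<in>\<D>. 0 < meshsize D \<and> meshsize D \<le> h0 \<and>
        tetrahedral_partition \<Omega> (bgmesh D) \<and>
        closed_surface (dsurface D) \<and> dsurface D \<subseteq> \<Omega> \<and>
        unit_normal_field (dsurface D) (dnormal D) \<and>
        stabilization_form p D) \<and>
     (\<exists>c. \<forall>D\<in>\<D>. quasi_uniform c (meshsize D) (bgmesh D)) \<and>
     (\<exists>c. \<forall>D\<in>\<D>. shape_regular c (bgmesh D))"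


section \<open>The stiffness matrix and its condition number\<close>

definition nodal_basis :: "nat \<Rightarrow> discretization \<Rightarrow> nat \<Rightarrow> (nat \<Rightarrow> scalar_fun) \<Rightarrow> bool" where
  "nodal_basis p D N \<phi> \<longleftrightarrow>
     (\<exists>z :: nat \<Rightarrow> pt. bij_betw z {..<N} (\<Union>T\<in>active_mesh D. lagrange_nodes p T) \<and>
        (\<forall>i<N. \<phi> i \<in> active_fe_space p D \<and> (\<forall>j<N. \<phi> i (z j) = (if i = j then 1 else 0))))"

definition fe_function :: "nat \<Rightarrow> (nat \<Rightarrow> scalar_fun) \<Rightarrow> real Matrix.vec \<Rightarrow> scalar_fun" where
  "fe_function N \<phi> u = (\<lambda>x. \<Sum>i<N. vec_index u i * \<phi> i x)"

definition coeff_space ::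
    "discretization \<Rightarrow> nat \<Rightarrow> (nat \<Rightarrow> scalar_fun) \<Rightarrow> real Matrix.vec set" where
  "coeff_space D N \<phi> =
     {u \<in> carrier_vec N. (\<Sum>i<N. vec_index u i * surface_integral D (\<phi> i)) = 0}"

text \<open>These conditions determine the operator uniquely on the coefficient space, and make it
  linear and symmetric there.\<close>

definition stiffness_operator ::
    "discretization \<Rightarrow> nat \<Rightarrow> (nat \<Rightarrow> scalar_fun) \<Rightarrow> (real Matrix.vec \<Rightarrow> real Matrix.vec) \<Rightarrow> bool" where
  "stiffness_operator D N \<phi> \<A> \<longleftrightarrow>
     (\<forall>w\<in>coeff_space D N \<phi>. \<A> w \<in> coeff_space D N \<phi>) \<and>
     (\<forall>w\<in>coeff_space D N \<phi>. \<forall>v\<in>coeff_space D N \<phi>.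
        scalar_prod (\<A> w) v = A_form D (fe_function N \<phi> w) (fe_function N \<phi> v))"

definition eigenvalues_on ::
    "nat \<Rightarrow> real Matrix.vec set \<Rightarrow> (real Matrix.vec \<Rightarrow> real Matrix.vec) \<Rightarrow> real set" where
  "eigenvalues_on N V \<A> = {\<mu>. \<exists>u\<in>V. u \<noteq> 0\<^sub>v N \<and> \<A> u = \<mu> \<cdot>\<^sub>v u}"

definition spectral_condition_number ::
    "nat \<Rightarrow> real Matrix.vec set \<Rightarrow> (real Matrix.vec \<Rightarrow> real Matrix.vec) \<Rightarrow> real" where
  "spectral_condition_number N V \<A> = Max (eigenvalues_on N V \<A>) / Min (eigenvalues_on N V \<A>)"

end

(*
  An eigenvalue mu with coefficient vector u and finite element function v satisfies
  mu |u|^2 = A_h(v,v) = ||v||_{A_h}^2. On a quasi-uniform, shape regular mesh |u|^2 is comparable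
  to h^{-3} ||v||_{L^2}^2, so the inverse inequality gives mu <= C and the Poincare inequality
  gives mu >= c h^2.

  The norm equivalence is proved element by element. In coordinates in which the Lagrange nodes
  are lattice points, a polynomial is expanded in products of binomial coefficients (Newton's
  basis); the coefficients are controlled by the nodal values, hence so are the maximum and the
  modulus of continuity on the element. Therefore the polynomial is bounded by its largest nodal
  value, and it stays above half of that value on a copy of the element shrunk by a fixed factor
  towards the node.

  For v to have mean zero the basis functions must be integrable over the surface: bi-Lipschitz
  charts give the surface finite area.
*)

theory Submission
  imports Defs
begin

no_notation Matrix.vec_index (infixl \<open>$\<close> 100)

section \<open>Polynomials in the Newton basis\<close>

text \<open>The obstacle is uniformity: all constants must be fixed before the mesh, the element and
  the cut. Equivalence of norms on a finite-dimensional space would serve one element at a time, so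
  every tetrahedron is pulled back to the same set \<open>corner p\<close>, where inverting a
  triangular integer matrix gives constants that depend on p alone. The two facts taken from there,
  control of the maximum and largeness on a homothetic copy, are invariant under affine maps and are
  restated without the map. Integrals are then compared on the element itself, so that its shape
  enters only through \<open>measure lebesgue T\<close>. Shape regularity and quasi-uniformity come
  in afterwards, to compare that measure with h^3 and to limit the number of elements at a node. All
  estimates are made on whole elements of the active mesh, so the position of the surface inside
  them does not enter the constants.\<close>

definition newton :: "(3 \<Rightarrow> nat) \<Rightarrow> scalar_fun" where
  "newton \<alpha> x = (\<Prod>i\<in>UNIV. (x $ i) gchoose \<alpha> i)"

definition newton_span :: "nat \<Rightarrow> scalar_fun set" where
  "newton_span p = {q. \<exists>d. \<forall>x. q x = (\<Sum>\<alpha> | sum \<alpha> UNIV \<le> p. d \<alpha> * newton \<alpha> x)}"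

definition lattice_point :: "(3 \<Rightarrow> nat) \<Rightarrow> pt" where
  "lattice_point \<alpha> = (\<chi> i. real (\<alpha> i))"

lemma finite_multi_indices [simp]: "finite {\<alpha> :: 3 \<Rightarrow> nat. sum \<alpha> UNIV \<le> p}"
proof -
  have "{\<alpha> :: 3 \<Rightarrow> nat. sum \<alpha> UNIV \<le> p} \<subseteq> PiE UNIV (\<lambda>_. {..p})"
  proof (clarsimp simp: PiE_def)
    fix \<alpha> :: "3 \<Rightarrow> nat" and i assume "sum \<alpha> UNIV \<le> p"
    moreover have "\<alpha> i \<le> sum \<alpha> UNIV" by (rule member_le_sum) auto
    ultimately show "\<alpha> i \<le> p" by simp
  qed
  then show ?thesis
    by (rule finite_subset) (auto intro: finite_PiE)
qed

section \<open>Closure of the Newton span under linear combinations and affine factors\<close>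

lemma newton_span_add:
  assumes "u \<in> newton_span p" "v \<in> newton_span p"
  shows "(\<lambda>x. u x + v x) \<in> newton_span p"
proof -
  obtain d e where "\<forall>x. u x = (\<Sum>\<alpha> | sum \<alpha> UNIV \<le> p. d \<alpha> * newton \<alpha> x)"
    "\<forall>x. v x = (\<Sum>\<alpha> | sum \<alpha> UNIV \<le> p. e \<alpha> * newton \<alpha> x)"
    using assms by (auto simp: newton_span_def)
  then show ?thesis
    unfolding newton_span_def
    by (intro CollectI exI[of _ "\<lambda>\<alpha>. d \<alpha> + e \<alpha>"]) (simp add: distrib_right sum.distrib)
qed

lemma newton_span_scale:
  assumes "u \<in> newton_span p"
  shows "(\<lambda>x. c * u x) \<in> newton_span p"
proof -
  obtain d where "\<forall>x. u x = (\<Sum>\<alpha> | sum \<alpha> UNIV \<le> p. d \<alpha> * newton \<alpha> x)"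
    using assms by (auto simp: newton_span_def)
  then show ?thesis
    unfolding newton_span_def
    by (intro CollectI exI[of _ "\<lambda>\<alpha>. c * d \<alpha>"]) (simp add: sum_distrib_left mult.assoc)
qed

lemma newton_span_sum:
  assumes "\<And>i. i \<in> I \<Longrightarrow> u i \<in> newton_span p"
  shows "(\<lambda>x. \<Sum>i\<in>I. u i x) \<in> newton_span p"
proof -
  have zero: "(\<lambda>x. 0) \<in> newton_span p"
    unfolding newton_span_def by (intro CollectI exI[of _ "\<lambda>_. 0"]) simp
  show ?thesis
    using assms by (induction I rule: infinite_finite_induct) (auto simp: zero intro: newton_span_add)
qed

lemma newton_in_span:
  assumes "sum \<alpha> UNIV \<le> p"
  shows "newton \<alpha> \<in> newton_span p"
  unfolding newton_span_def
proof (intro CollectI exI allI)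
  fix x
  have "(\<Sum>\<beta> | sum \<beta> UNIV \<le> p. of_bool (\<beta> = \<alpha>) * newton \<beta> x)
    = (\<Sum>\<beta> | sum \<beta> UNIV \<le> p. if \<beta> = \<alpha> then newton \<beta> x else 0)"
    by (intro sum.cong) auto
  then show "newton \<alpha> x = (\<Sum>\<beta> | sum \<beta> UNIV \<le> p. of_bool (\<beta> = \<alpha>) * newton \<beta> x)"
    using assms by simp
qed

lemma newton_span_mono:
  assumes "u \<in> newton_span p" "p \<le> r"
  shows "u \<in> newton_span r"
proof -
  obtain d where "u = (\<lambda>x. \<Sum>\<alpha> | sum \<alpha> UNIV \<le> p. d \<alpha> * newton \<alpha> x)"
    using assms(1) by (auto simp: newton_span_def)
  moreover have "(\<lambda>x. \<Sum>\<alpha> | sum \<alpha> UNIV \<le> p. d \<alpha> * newton \<alpha> x) \<in> newton_span r"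
    using assms(2) by (intro newton_span_sum newton_span_scale newton_in_span) auto
  ultimately show ?thesis by simp
qed

lemma const_in_newton_span: "(\<lambda>x. c) \<in> newton_span p"
proof -
  have "newton (\<lambda>_. 0) \<in> newton_span p" by (intro newton_in_span) simp
  from newton_span_scale[OF this, of c] show ?thesis by (simp add: newton_def)
qed

text \<open>This is the one-variable identity x C(x,k) = k C(x,k) + (k+1) C(x,k+1) in factor j, the
  other factors being untouched. Multiplication by a coordinate therefore raises the degree in the
  Newton basis by exactly one.\<close>

lemma coordinate_mult_newton:
  "x $ j * newton \<alpha> x = real (\<alpha> j) * newton \<alpha> x + real (Suc (\<alpha> j)) * newton (\<alpha>(j := Suc (\<alpha> j))) x"
proof -
  have split: "newton \<beta> x = (x $ j gchoose \<beta> j) * (\<Prod>i\<in>UNIV - {j}. x $ i gchoose \<beta> i)" for \<beta>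
    unfolding newton_def by (rule prod.remove) auto
  have "(\<Prod>i\<in>UNIV - {j}. x $ i gchoose (\<alpha>(j := Suc (\<alpha> j))) i) = (\<Prod>i\<in>UNIV - {j}. x $ i gchoose \<alpha> i)"
    by (intro prod.cong) auto
  then have "newton (\<alpha>(j := Suc (\<alpha> j))) x = (x $ j gchoose Suc (\<alpha> j)) * (\<Prod>i\<in>UNIV - {j}. x $ i gchoose \<alpha> i)"
    by (simp add: split)
  then show ?thesis
    using gbinomial_mult_1[of "x $ j" "\<alpha> j"] unfolding split[of \<alpha>]
    by (metis (no_types, lifting) distrib_right mult.assoc)
qed

lemma sum_fun_upd_Suc:
  fixes \<alpha> :: "3 \<Rightarrow> nat"
  shows "sum (\<alpha>(j := Suc (\<alpha> j))) UNIV = Suc (sum \<alpha> UNIV)"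
proof -
  have "sum (\<alpha>(j := Suc (\<alpha> j))) UNIV = Suc (\<alpha> j) + sum (\<alpha>(j := Suc (\<alpha> j))) (UNIV - {j})"
    by (subst sum.remove[of _ j]) auto
  also have "sum (\<alpha>(j := Suc (\<alpha> j))) (UNIV - {j}) = sum \<alpha> (UNIV - {j})"
    by (intro sum.cong) auto
  finally show ?thesis by (simp add: sum.remove[of UNIV j \<alpha>])
qed

lemma coordinate_mult_newton_span:
  assumes "u \<in> newton_span p"
  shows "(\<lambda>x. x $ j * u x) \<in> newton_span (Suc p)"
proof -
  obtain d where d: "\<forall>x. u x = (\<Sum>\<alpha> | sum \<alpha> UNIV \<le> p. d \<alpha> * newton \<alpha> x)"
    using assms by (auto simp: newton_span_def)
  have "(\<lambda>x. x $ j * u x) = (\<lambda>x. \<Sum>\<alpha> | sum \<alpha> UNIV \<le> p. d \<alpha> * (real (\<alpha> j) * newton \<alpha> x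
      + real (Suc (\<alpha> j)) * newton (\<alpha>(j := Suc (\<alpha> j))) x))"
    unfolding coordinate_mult_newton[symmetric] using d
    by (simp add: sum_distrib_left mult.left_commute)
  also have "\<dots> \<in> newton_span (Suc p)"
    by (intro newton_span_sum newton_span_scale newton_span_add newton_in_span)
       (auto simp del: fun_upd_apply simp: sum_fun_upd_Suc)
  finally show ?thesis .
qed

lemma affine_mult_newton_span:
  assumes "u \<in> newton_span p"
  shows "(\<lambda>x. (b + (\<Sum>j\<in>UNIV. x $ j * c j)) * u x) \<in> newton_span (Suc p)"
proof -
  have "(\<lambda>x. (b + (\<Sum>j\<in>UNIV. x $ j * c j)) * u x) = (\<lambda>x. b * u x + (\<Sum>j\<in>UNIV. c j * (x $ j * u x)))"
    by (simp add: algebra_simps sum_distrib_left)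
  also have "\<dots> \<in> newton_span (Suc p)"
    by (intro newton_span_add newton_span_sum newton_span_scale coordinate_mult_newton_span assms
        newton_span_mono[OF assms]) auto
  finally show ?thesis .
qed

lemma affine_power_newton_span:
  "u \<in> newton_span p \<Longrightarrow> (\<lambda>x. (b + (\<Sum>j\<in>UNIV. x $ j * c j)) ^ n * u x) \<in> newton_span (n + p)"
proof (induction n)
  case (Suc n)
  then show ?case
    using affine_mult_newton_span[of "\<lambda>x. (b + (\<Sum>j\<in>UNIV. x $ j * c j)) ^ n * u x" "n + p" b c]
    by (simp add: mult.assoc)
qed simp

text \<open>Every affine factor costs one degree, so replacing the coordinates of a monomial by
  affine functions keeps its total degree as a bound.\<close>

lemma affine_monomial_newton_span:
  fixes c :: "3 \<Rightarrow> 3 \<Rightarrow> real"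
  shows "(\<lambda>x. \<Prod>i\<in>I. (b i + (\<Sum>j\<in>UNIV. x $ j * c i j)) ^ \<alpha> i) \<in> newton_span (sum \<alpha> I)"
proof (induction I rule: infinite_finite_induct)
  case (insert i I)
  then show ?case
    using affine_power_newton_span[OF insert.IH, of "b i" "c i" "\<alpha> i"] by (simp add: add.commute)
qed (auto simp: const_in_newton_span)

text \<open>Change of coordinates and change of basis in one step. The target space is the same for
  every \<open>a\<close> and \<open>e\<close>; this is what later makes the constants independent of
  the tetrahedron.\<close>

lemma polynomials_compose_affine:
  fixes e :: "3 \<Rightarrow> pt"
  assumes "q \<in> polynomials p"
  shows "(\<lambda>t. q (a + (\<Sum>j\<in>UNIV. (t $ j) *\<^sub>R e j))) \<in> newton_span p"
proof -
  obtain c where c: "\<forall>x. q x = (\<Sum>\<alpha> | sum \<alpha> UNIV \<le> p. c \<alpha> * (\<Prod>i\<in>UNIV. (x $ i) ^ \<alpha> i))"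
    using assms by (auto simp: polynomials_def)
  have "(\<lambda>t. \<Prod>i\<in>UNIV. ((a + (\<Sum>j\<in>UNIV. (t $ j) *\<^sub>R e j)) $ i) ^ \<alpha> i) \<in> newton_span p"
    if "sum \<alpha> UNIV \<le> p" for \<alpha> :: "3 \<Rightarrow> nat"
    using newton_span_mono[OF affine_monomial_newton_span[of "\<lambda>i. a $ i" "\<lambda>i j. e j $ i" \<alpha> UNIV] that]
    by (simp add: sum_component)
  then show ?thesis
    unfolding c[rule_format] by (intro newton_span_sum newton_span_scale) auto
qed

section \<open>Newton coefficients bounded by the values at lattice points\<close>

lemma newton_lattice_point: "newton \<beta> (lattice_point \<alpha>) = real (\<Prod>i\<in>UNIV. \<alpha> i choose \<beta> i)"
  by (simp add: newton_def lattice_point_def binomial_gbinomial)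

text \<open>The matrix \<open>newton \<beta> (lattice_point \<alpha>)\<close> is unitriangular for the order by total degree,
  so the coefficients can be bounded successively by the values at the lattice points.\<close>

lemma newton_coefficient_bound:
  "\<exists>K>0. \<forall>d M \<alpha>. sum \<alpha> UNIV \<le> m \<longrightarrow> sum \<alpha> UNIV \<le> p \<longrightarrow>
    (\<forall>\<beta>. sum \<beta> UNIV \<le> p \<longrightarrow>
       \<bar>\<Sum>\<gamma> | sum \<gamma> UNIV \<le> p. d \<gamma> * newton \<gamma> (lattice_point \<beta>)\<bar> \<le> M) \<longrightarrow> \<bar>d \<alpha>\<bar> \<le> K * M"
proof (induction m)
  case 0
  have "\<bar>d \<alpha>\<bar> \<le> 1 * M" if "sum \<alpha> UNIV \<le> 0"
    and "\<forall>\<beta>. sum \<beta> UNIV \<le> p \<longrightarrow>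
       \<bar>\<Sum>\<gamma> | sum \<gamma> UNIV \<le> p. d \<gamma> * newton \<gamma> (lattice_point \<beta>)\<bar> \<le> M" for d M and \<alpha> :: "3 \<Rightarrow> nat"
  proof -
    have a: "\<alpha> = (\<lambda>_. 0)" using that(1) by auto
    \<comment> \<open>At the origin every binomial with positive lower index vanishes, so the value
      there is the constant coefficient itself; hence the constant 1.\<close>
    have "newton \<gamma> (lattice_point \<alpha>) = of_bool (\<gamma> = \<alpha>)" for \<gamma>
      unfolding newton_lattice_point a by (auto simp: fun_eq_iff)
    then have "(\<Sum>\<gamma> | sum \<gamma> UNIV \<le> p. d \<gamma> * newton \<gamma> (lattice_point \<alpha>))
       = (\<Sum>\<gamma> | sum \<gamma> UNIV \<le> p. if \<gamma> = \<alpha> then d \<gamma> else 0)"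
      by (intro sum.cong) auto
    also have "\<dots> = d \<alpha>" using that(1) by simp
    finally show ?thesis using that(2)[rule_format, of \<alpha>] that(1) by simp
  qed
  then show ?case by (intro exI[of _ 1]) auto
next
  case (Suc m)
  then obtain K where K: "K > 0" and IH0: "\<forall>d M \<alpha>. sum \<alpha> UNIV \<le> m \<longrightarrow> sum \<alpha> UNIV \<le> p \<longrightarrow>
    (\<forall>\<beta>. sum \<beta> UNIV \<le> p \<longrightarrow>
       \<bar>\<Sum>\<gamma> | sum \<gamma> UNIV \<le> p. d \<gamma> * newton \<gamma> (lattice_point \<beta>)\<bar> \<le> M) \<longrightarrow> \<bar>d \<alpha>\<bar> \<le> K * M"
    by blast
  have IH: "\<bar>d \<alpha>\<bar> \<le> K * M" if "sum \<alpha> UNIV \<le> m" "sum \<alpha> UNIV \<le> p"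
    "\<And>\<beta>. sum \<beta> UNIV \<le> p \<Longrightarrow>
       \<bar>\<Sum>\<gamma> | sum \<gamma> UNIV \<le> p. d \<gamma> * newton \<gamma> (lattice_point \<beta>)\<bar> \<le> M" for d M \<alpha>
    using IH0 that by blast
  let ?I = "{\<gamma> :: 3 \<Rightarrow> nat. sum \<gamma> UNIV \<le> p}"
  \<comment> \<open>The sum of all matrix entries, a crude bound for every single row sum. In the
    new constant, \<open>K\<close> serves the lower degrees and \<open>1 + K * B\<close> the new
    one: one nodal value plus a row of lower coefficients.\<close>
  define B where "B = (\<Sum>\<alpha>\<in>?I. \<Sum>\<gamma>\<in>?I. \<bar>newton \<gamma> (lattice_point \<alpha>)\<bar>)"
  have B: "B \<ge> 0" unfolding B_def by (intro sum_nonneg) auto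
  have "\<bar>d \<alpha>\<bar> \<le> (K + (1 + K * B)) * M" if \<alpha>: "sum \<alpha> UNIV \<le> Suc m" "sum \<alpha> UNIV \<le> p"
    and M: "\<And>\<beta>. sum \<beta> UNIV \<le> p \<Longrightarrow>
       \<bar>\<Sum>\<gamma> | sum \<gamma> UNIV \<le> p. d \<gamma> * newton \<gamma> (lattice_point \<beta>)\<bar> \<le> M" for d M and \<alpha> :: "3 \<Rightarrow> nat"
  proof -
    have M0: "M \<ge> 0" using M[OF \<alpha>(2)] by linarith
    show ?thesis
    proof (cases "sum \<alpha> UNIV \<le> m")
      case True
      have "\<bar>d \<alpha>\<bar> \<le> K * M" using IH[OF True \<alpha>(2) M] by simp
      also have "\<dots> \<le> (K + (1 + K * B)) * M"
        using K B M0 by (intro mult_right_mono) auto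
      finally show ?thesis .
    next
      case False
      then have s: "sum \<alpha> UNIV = Suc m" using \<alpha> by simp
      have self: "newton \<alpha> (lattice_point \<alpha>) = 1" by (simp add: newton_lattice_point)
      \<comment> \<open>A nonzero product of binomials forces \<gamma> to lie below \<alpha> in each
        component. As \<gamma> differs from \<alpha>, its total degree is then strictly smaller and
        the induction hypothesis bounds its coefficient.\<close>
      have small: "\<bar>d \<gamma> * newton \<gamma> (lattice_point \<alpha>)\<bar> \<le> K * M * \<bar>newton \<gamma> (lattice_point \<alpha>)\<bar>"
        if "\<gamma> \<in> ?I - {\<alpha>}" for \<gamma>
      proof (cases "newton \<gamma> (lattice_point \<alpha>) = 0")
        case False
        then have le: "\<gamma> i \<le> \<alpha> i" for i
          unfolding newton_lattice_point using not_less by auto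
        have "sum \<gamma> UNIV \<noteq> sum \<alpha> UNIV"
        proof
          assume "sum \<gamma> UNIV = sum \<alpha> UNIV"
          then have "\<gamma> i = \<alpha> i" for i
            using sum_mono_inv[of \<gamma> UNIV \<alpha> i] le by auto
          then show False using that by auto
        qed
        then have "sum \<gamma> UNIV \<le> m"
          using sum_mono[of UNIV \<gamma> \<alpha>] le s by auto
        then have "\<bar>d \<gamma>\<bar> \<le> K * M" using IH[of \<gamma> d M] that M by auto
        then show ?thesis by (simp add: abs_mult mult_right_mono)
      qed auto
      have "d \<alpha> = (\<Sum>\<gamma>\<in>?I. d \<gamma> * newton \<gamma> (lattice_point \<alpha>)) - (\<Sum>\<gamma>\<in>?I - {\<alpha>}. d \<gamma> * newton \<gamma> (lattice_point \<alpha>))"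
        using \<alpha> self by (subst sum.remove[of ?I \<alpha>]) auto
      then have "\<bar>d \<alpha>\<bar> \<le> M + (\<Sum>\<gamma>\<in>?I - {\<alpha>}. \<bar>d \<gamma> * newton \<gamma> (lattice_point \<alpha>)\<bar>)"
        using M[OF \<alpha>(2)] sum_abs[of "\<lambda>\<gamma>. d \<gamma> * newton \<gamma> (lattice_point \<alpha>)" "?I - {\<alpha>}"] by linarith
      also have "(\<Sum>\<gamma>\<in>?I - {\<alpha>}. \<bar>d \<gamma> * newton \<gamma> (lattice_point \<alpha>)\<bar>)
          \<le> (\<Sum>\<gamma>\<in>?I - {\<alpha>}. K * M * \<bar>newton \<gamma> (lattice_point \<alpha>)\<bar>)"
        by (intro sum_mono small)
      also have "\<dots> \<le> (\<Sum>\<gamma>\<in>?I. K * M * \<bar>newton \<gamma> (lattice_point \<alpha>)\<bar>)"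
        using K M0 by (intro sum_mono2) auto
      also have "\<dots> = K * M * (\<Sum>\<gamma>\<in>?I. \<bar>newton \<gamma> (lattice_point \<alpha>)\<bar>)"
        by (simp add: sum_distrib_left)
      also have "(\<Sum>\<gamma>\<in>?I. \<bar>newton \<gamma> (lattice_point \<alpha>)\<bar>) \<le> B"
        unfolding B_def using \<alpha>
        by (intro member_le_sum[of \<alpha> ?I "\<lambda>\<alpha>. \<Sum>\<gamma>\<in>?I. \<bar>newton \<gamma> (lattice_point \<alpha>)\<bar>"] sum_nonneg) auto
      then have "K * M * (\<Sum>\<gamma>\<in>?I. \<bar>newton \<gamma> (lattice_point \<alpha>)\<bar>) \<le> K * M * B"
        using K M0 by (intro mult_left_mono) auto
      finally show ?thesis using K M0 by (simp add: algebra_simps) (smt (verit) mult_nonneg_nonneg)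
    qed
  qed
  then show ?case
    using K B by (intro exI[of _ "K + (1 + K * B)"]) (auto simp: add_pos_nonneg)
qed

section \<open>Uniform bounds and moduli of continuity on compact sets\<close>

lemma continuous_newton: "continuous_on UNIV (newton \<alpha>)"
  unfolding newton_def gbinomial_prod_rev by (intro continuous_intros) auto

lemma newton_bounded:
  assumes "compact S"
  shows "\<exists>B>0. \<forall>\<alpha>. sum \<alpha> UNIV \<le> p \<longrightarrow> (\<forall>x\<in>S. \<bar>newton \<alpha> x\<bar> \<le> B)"
proof -
  let ?I = "{\<alpha> :: 3 \<Rightarrow> nat. sum \<alpha> UNIV \<le> p}"
  have "bounded (newton \<alpha> ` S)" for \<alpha>
    using assms continuous_on_subset[OF continuous_newton]
    by (intro compact_imp_bounded compact_continuous_image) auto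
  then have "bounded (\<Union>\<alpha>\<in>?I. newton \<alpha> ` S)"
    by (intro bounded_UN) auto
  then show ?thesis
    unfolding bounded_pos by (auto simp: Bex_def)
qed

lemma newton_uniformly_continuous:
  assumes "compact S" "e > 0"
  shows "\<exists>d>0. \<forall>\<alpha>. sum \<alpha> UNIV \<le> p \<longrightarrow> (\<forall>x\<in>S. \<forall>y\<in>S. dist x y < d \<longrightarrow> \<bar>newton \<alpha> x - newton \<alpha> y\<bar> < e)"
proof -
  let ?I = "{\<alpha> :: 3 \<Rightarrow> nat. sum \<alpha> UNIV \<le> p}"
  have "\<exists>d>0. \<forall>x\<in>S. \<forall>y\<in>S. dist x y < d \<longrightarrow> \<bar>newton \<alpha> x - newton \<alpha> y\<bar> < e" for \<alpha>
  proof -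
    have "uniformly_continuous_on S (newton \<alpha>)"
      using assms continuous_on_subset[OF continuous_newton] by (intro compact_uniformly_continuous) auto
    then obtain d where "d > 0" "\<forall>x\<in>S. \<forall>y\<in>S. dist y x < d \<longrightarrow> dist (newton \<alpha> y) (newton \<alpha> x) < e"
      using assms(2) unfolding uniformly_continuous_on_def by meson
    then show ?thesis by (intro exI[of _ d]) (auto simp: dist_real_def)
  qed
  then obtain d where d: "\<And>\<alpha>. d \<alpha> > 0"
    "\<And>\<alpha> x y. x \<in> S \<Longrightarrow> y \<in> S \<Longrightarrow> dist x y < d \<alpha> \<Longrightarrow> \<bar>newton \<alpha> x - newton \<alpha> y\<bar> < e"
    by metis
  have ne: "d ` ?I \<noteq> {}"
    by (auto intro: exI[of _ "\<lambda>_. 0"])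
  show ?thesis
  proof (intro exI conjI allI impI ballI)
    show "Min (d ` ?I) > 0" using ne d by auto
    fix \<alpha> :: "3 \<Rightarrow> nat" and x y
    assume "sum \<alpha> UNIV \<le> p" "x \<in> S" "y \<in> S" "dist x y < Min (d ` ?I)"
    moreover from this have "Min (d ` ?I) \<le> d \<alpha>" by (intro Min_le) auto
    ultimately show "\<bar>newton \<alpha> x - newton \<alpha> y\<bar> < e" using d(2)[of x y \<alpha>] by linarith
  qed
qed

lemma newton_span_bound:
  assumes "compact S"
  shows "\<exists>K>0. \<forall>q\<in>newton_span p. \<forall>M. (\<forall>\<beta>. sum \<beta> UNIV \<le> p \<longrightarrow> \<bar>q (lattice_point \<beta>)\<bar> \<le> M) \<longrightarrow>
    (\<forall>x\<in>S. \<bar>q x\<bar> \<le> K * M)"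
proof -
  let ?I = "{\<alpha> :: 3 \<Rightarrow> nat. sum \<alpha> UNIV \<le> p}"
  obtain B where B: "B > 0" "\<And>\<alpha> x. sum \<alpha> UNIV \<le> p \<Longrightarrow> x \<in> S \<Longrightarrow> \<bar>newton \<alpha> x\<bar> \<le> B"
    using newton_bounded[OF assms, of p] by blast
  obtain K where K: "K > 0" and bound: "\<forall>d M \<alpha>. sum \<alpha> UNIV \<le> p \<longrightarrow> sum \<alpha> UNIV \<le> p \<longrightarrow>
    (\<forall>\<beta>. sum \<beta> UNIV \<le> p \<longrightarrow>
       \<bar>\<Sum>\<gamma> | sum \<gamma> UNIV \<le> p. d \<gamma> * newton \<gamma> (lattice_point \<beta>)\<bar> \<le> M) \<longrightarrow> \<bar>d \<alpha>\<bar> \<le> K * M"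
    using newton_coefficient_bound[of p p] by blast
  have card: "card ?I > 0" by (auto simp: card_gt_0_iff intro: exI[of _ "\<lambda>_. 0"])
  show ?thesis
  proof (intro exI[of _ "real (card ?I) * (K * B)"] conjI ballI allI impI)
    show "real (card ?I) * (K * B) > 0" using card K B by simp
    fix q M x
    assume q: "q \<in> newton_span p" and M: "\<forall>\<beta>. sum \<beta> UNIV \<le> p \<longrightarrow> \<bar>q (lattice_point \<beta>)\<bar> \<le> M" and x: "x \<in> S"
    obtain d where d: "\<forall>x. q x = (\<Sum>\<alpha>\<in>?I. d \<alpha> * newton \<alpha> x)"
      using q by (auto simp: newton_span_def)
    have dK: "\<bar>d \<alpha>\<bar> \<le> K * M" if "\<alpha> \<in> ?I" for \<alpha>
      using bound[rule_format, of \<alpha> d M] M that d by auto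
    have "\<bar>q x\<bar> \<le> (\<Sum>\<alpha>\<in>?I. \<bar>d \<alpha> * newton \<alpha> x\<bar>)" using d by simp
    also have "\<dots> \<le> (\<Sum>\<alpha>\<in>?I. K * M * B)"
      using dK B(2)[OF _ x] unfolding abs_mult by (intro sum_mono mult_mono) (auto intro: order_trans[OF abs_ge_zero])
    finally show "\<bar>q x\<bar> \<le> real (card ?I) * (K * B) * M" by (simp add: mult_ac)
  qed
qed

text \<open>One radius serves all q at once: only finitely many Newton polynomials occur, and the
  coefficients are proportional to the bound M of the lattice values.\<close>

lemma newton_span_modulus:
  assumes "compact S" "e > 0"
  shows "\<exists>r>0. \<forall>q\<in>newton_span p. \<forall>M. (\<forall>\<beta>. sum \<beta> UNIV \<le> p \<longrightarrow> \<bar>q (lattice_point \<beta>)\<bar> \<le> M) \<longrightarrow>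
    (\<forall>x\<in>S. \<forall>y\<in>S. dist x y < r \<longrightarrow> \<bar>q x - q y\<bar> \<le> e * M)"
proof -
  let ?I = "{\<alpha> :: 3 \<Rightarrow> nat. sum \<alpha> UNIV \<le> p}"
  obtain K where K: "K > 0" and bound: "\<forall>d M \<alpha>. sum \<alpha> UNIV \<le> p \<longrightarrow> sum \<alpha> UNIV \<le> p \<longrightarrow>
    (\<forall>\<beta>. sum \<beta> UNIV \<le> p \<longrightarrow>
       \<bar>\<Sum>\<gamma> | sum \<gamma> UNIV \<le> p. d \<gamma> * newton \<gamma> (lattice_point \<beta>)\<bar> \<le> M) \<longrightarrow> \<bar>d \<alpha>\<bar> \<le> K * M"
    using newton_coefficient_bound[of p p] by blast
  have card: "card ?I > 0" by (auto simp: card_gt_0_iff intro: exI[of _ "\<lambda>_. 0"])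
  define n where "n = real (card ?I)"
  have n: "n > 0" using card by (simp add: n_def)
  \<comment> \<open>The tolerance is shared among the n terms of the sum, each with a coefficient of
    size at most \<open>K * M\<close>, so that the total is \<open>e * M\<close>.\<close>
  define e' where "e' = e / (n * K)"
  have e': "e' > 0" using assms(2) K n by (simp add: e'_def)
  obtain r where r: "r > 0" "\<And>\<alpha> x y. sum \<alpha> UNIV \<le> p \<Longrightarrow> x \<in> S \<Longrightarrow> y \<in> S \<Longrightarrow> dist x y < r \<Longrightarrow>
      \<bar>newton \<alpha> x - newton \<alpha> y\<bar> < e'"
    using newton_uniformly_continuous[OF assms(1) e', of p] by blast
  show ?thesis
  proof (intro exI[of _ r] conjI ballI allI impI r(1))
    fix q M x y
    assume q: "q \<in> newton_span p" and M: "\<forall>\<beta>. sum \<beta> UNIV \<le> p \<longrightarrow> \<bar>q (lattice_point \<beta>)\<bar> \<le> M"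
      and xy: "x \<in> S" "y \<in> S" "dist x y < r"
    obtain d where d: "\<forall>x. q x = (\<Sum>\<alpha>\<in>?I. d \<alpha> * newton \<alpha> x)"
      using q by (auto simp: newton_span_def)
    have dK: "\<bar>d \<alpha>\<bar> \<le> K * M" if "\<alpha> \<in> ?I" for \<alpha>
      using bound[rule_format, of \<alpha> d M] M that d by auto
    have "q x - q y = (\<Sum>\<alpha>\<in>?I. d \<alpha> * (newton \<alpha> x - newton \<alpha> y))"
      using d by (simp add: sum_subtractf right_diff_distrib)
    then have "\<bar>q x - q y\<bar> \<le> (\<Sum>\<alpha>\<in>?I. \<bar>d \<alpha> * (newton \<alpha> x - newton \<alpha> y)\<bar>)" by simp
    also have "\<dots> \<le> (\<Sum>\<alpha>\<in>?I. K * M * e')"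
      using dK less_imp_le[OF r(2)[OF _ xy]] unfolding abs_mult
      by (intro sum_mono mult_mono) (auto intro: order_trans[OF abs_ge_zero])
    also have "\<dots> = n * (K * M * e')" by (simp add: n_def)
    also have "\<dots> = e * M" using K n by (simp add: e'_def)
    finally show "\<bar>q x - q y\<bar> \<le> e * M" .
  qed
qed

section \<open>Polynomials on a tetrahedron\<close>

text \<open>Reference tetrahedron with edges of length p along the axes instead of 1, so that the
  Lagrange nodes of degree p are its integer points and the Newton polynomials take binomial values
  there.\<close>

definition corner :: "nat \<Rightarrow> pt set" where
  "corner p = {t. (\<forall>i. 0 \<le> t $ i) \<and> (\<Sum>i\<in>UNIV. t $ i) \<le> real p}"

definition affine_map :: "pt \<Rightarrow> (3 \<Rightarrow> pt) \<Rightarrow> pt \<Rightarrow> pt" where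
  "affine_map a e t = a + (\<Sum>j\<in>UNIV. (t $ j) *\<^sub>R e j)"

lemma compact_corner: "compact (corner p)"
proof -
  have "closed (corner p)"
    unfolding corner_def
    by (intro closed_Collect_conj closed_Collect_all closed_Collect_le continuous_intros)
  moreover have "corner p \<subseteq> cbox 0 (\<chi> i. real p)"
  proof
    fix t assume t: "t \<in> corner p"
    have "t $ i \<le> (\<Sum>i\<in>UNIV. t $ i)" for i
      using t by (intro member_le_sum) (auto simp: corner_def)
    with t show "t \<in> cbox 0 (\<chi> i. real p)"
      unfolding corner_def mem_box_cart by (auto intro: order_trans)
  qed
  then have "bounded (corner p)" using bounded_cbox bounded_subset by blast
  ultimately show ?thesis by (simp add: compact_eq_bounded_closed)
qed

lemma lattice_point_in_corner: "sum \<alpha> UNIV \<le> p \<Longrightarrow> lattice_point \<alpha> \<in> corner p"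
  by (simp add: corner_def lattice_point_def flip: of_nat_sum)

text \<open>Since the weights sum to 1, that of the chosen vertex can be eliminated; the other three
  become free coordinates along the edges that leave it.\<close>

lemma convex_combination_from_vertex:
  fixes w :: "pt \<Rightarrow> real"
  assumes "finite C" "c\<^sub>0 \<in> C" and a: "bij_betw a (UNIV :: 3 set) (C - {c\<^sub>0})" and "sum w C = 1"
  shows "(\<Sum>c\<in>C. w c *\<^sub>R c) = c\<^sub>0 + (\<Sum>j\<in>UNIV. w (a j) *\<^sub>R (a j - c\<^sub>0))"
proof -
  have w0: "w c\<^sub>0 = 1 - sum w (C - {c\<^sub>0})"
    using assms by (simp add: sum.remove[of C c\<^sub>0])
  have "(\<Sum>c\<in>C. w c *\<^sub>R c) = w c\<^sub>0 *\<^sub>R c\<^sub>0 + (\<Sum>c\<in>C - {c\<^sub>0}. w c *\<^sub>R c)"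
    using assms by (simp add: sum.remove[of C c\<^sub>0])
  also have "\<dots> = c\<^sub>0 + (\<Sum>c\<in>C - {c\<^sub>0}. w c *\<^sub>R (c - c\<^sub>0))"
    by (simp add: w0 scaleR_left_diff_distrib scaleR_right_diff_distrib sum_subtractf scaleR_left.sum)
  also have "(\<Sum>c\<in>C - {c\<^sub>0}. w c *\<^sub>R (c - c\<^sub>0)) = (\<Sum>j\<in>UNIV. w (a j) *\<^sub>R (a j - c\<^sub>0))"
    using sum.reindex_bij_betw[OF a, of "\<lambda>c. w c *\<^sub>R (c - c\<^sub>0)"] by simp
  finally show ?thesis .
qed

text \<open>Barycentric coordinates multiplied by p: the origin \<open>a\<close> is a vertex and the
  \<open>e j\<close> are the edges from it divided by p. The weights k/p of a Lagrange node turn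
  into the integers k.\<close>

lemma simplex_parametrization:
  assumes "3 simplex T" "p \<ge> 1"
  obtains a e where "T = affine_map a e ` corner p"
    and "lagrange_nodes p T = affine_map a e ` lattice_point ` {\<alpha>. sum \<alpha> UNIV \<le> p}"
proof -
  obtain C where C: "\<not> affine_dependent C" "card C = 4" "T = convex hull C"
    using assms(1) by (auto simp: simplex_def)
  have fin: "finite C" using C(2) by (metis card.infinite zero_neq_numeral)
  obtain c0 where c0: "c0 \<in> C" using C(2) by fastforce
  have "card (C - {c0}) = card (UNIV :: 3 set)" using C c0 fin by simp
  then obtain a where a: "bij_betw a (UNIV :: 3 set) (C - {c0})"
    using fin by (metis bij_betw_iff_card finite finite_Diff)
  define b where "b = inv_into UNIV a"
  have inj: "inj a" using a by (simp add: bij_betw_def)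
  have ba: "b (a j) = j" for j unfolding b_def using inj by simp
  have ac: "a j \<in> C" "a j \<noteq> c0" for j using a by (auto simp: bij_betw_def)
  have p: "real p > 0" using assms(2) by simp
  define e where "e j = (1 / real p) *\<^sub>R (a j - c0)" for j
  have comb: "(\<Sum>c\<in>C. w c *\<^sub>R c) = affine_map c0 e (\<chi> j. real p * w (a j))" if "sum w C = 1" for w
    using convex_combination_from_vertex[OF fin c0 a that] p by (simp add: affine_map_def e_def)
  have reindex: "sum f C = f c0 + (\<Sum>j\<in>UNIV. f (a j))" for f :: "pt \<Rightarrow> 'a::comm_monoid_add"
    using sum.reindex_bij_betw[OF a, of f] fin c0 by (simp add: sum.remove[of C c0])
  have "T = affine_map c0 e ` corner p"
  proof
    show "T \<subseteq> affine_map c0 e ` corner p"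
    proof
      fix x assume "x \<in> T"
      then obtain w where w: "\<forall>c\<in>C. 0 \<le> w c" "sum w C = 1" "(\<Sum>c\<in>C. w c *\<^sub>R c) = x"
        unfolding C(3) convex_hull_finite[OF fin] by blast
      have "(\<Sum>j\<in>UNIV. w (a j)) \<le> 1" using w(1)[rule_format, OF c0] w(2) reindex[of w] by linarith
      then have "(\<Sum>j\<in>UNIV. real p * w (a j)) \<le> real p"
        using p by (simp flip: sum_distrib_left)
      then have "(\<chi> j. real p * w (a j)) \<in> corner p"
        using w(1) ac by (simp add: corner_def)
      then show "x \<in> affine_map c0 e ` corner p" using comb[OF w(2)] w(3) by blast
    qed
    show "affine_map c0 e ` corner p \<subseteq> T"
    proof
      fix x assume "x \<in> affine_map c0 e ` corner p"
      then obtain t where t: "t \<in> corner p" "x = affine_map c0 e t" by blast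
      \<comment> \<open>The inverse of the elimination: the base vertex receives the weight that the
        three coordinates leave over.\<close>
      define w where "w c = (if c = c0 then 1 - (\<Sum>j\<in>UNIV. t $ j) / real p else t $ b c / real p)" for c
      have wa: "w (a j) = t $ j / real p" for j by (simp add: w_def ba ac)
      have "sum w C = 1" by (simp add: reindex wa) (simp add: w_def sum_divide_distrib)
      moreover from comb[OF this] have "(\<Sum>c\<in>C. w c *\<^sub>R c) = x"
        using p by (simp add: wa t(2))
      moreover have "0 \<le> w c" for c using t(1) p by (auto simp: w_def corner_def)
      ultimately show "x \<in> T" unfolding C(3) convex_hull_finite[OF fin] by blast
    qed
  qed
  moreover have "lagrange_nodes p T = affine_map c0 e ` lattice_point ` {\<alpha>. sum \<alpha> UNIV \<le> p}"
  proof -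
    have nodes: "lagrange_nodes p T = {x. \<exists>k :: pt \<Rightarrow> nat. sum k C = p \<and> x = (\<Sum>c\<in>C. (real (k c) / real p) *\<^sub>R c)}"
      unfolding lagrange_nodes_def C(3) by (simp add: extreme_point_of_convex_hull_affine_independent[OF C(1)])
    have k: "(\<Sum>c\<in>C. (real (k c) / real p) *\<^sub>R c) = affine_map c0 e (lattice_point (\<lambda>j. k (a j)))"
      if "sum k C = p" for k :: "pt \<Rightarrow> nat"
    proof -
      have "(\<Sum>c\<in>C. real (k c) / real p) = 1"
        using that p by (simp flip: sum_divide_distrib of_nat_sum)
      from comb[OF this] show ?thesis using p by (simp add: lattice_point_def)
    qed
    show ?thesis
    proof
      show "lagrange_nodes p T \<subseteq> affine_map c0 e ` lattice_point ` {\<alpha>. sum \<alpha> UNIV \<le> p}"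
      proof
        fix x assume "x \<in> lagrange_nodes p T"
        then obtain k where k': "sum k C = p" "x = (\<Sum>c\<in>C. (real (k c) / real p) *\<^sub>R c)"
          using nodes by auto
        have "(\<Sum>j\<in>UNIV. k (a j)) \<le> p" using k'(1) by (simp add: reindex)
        then show "x \<in> affine_map c0 e ` lattice_point ` {\<alpha>. sum \<alpha> UNIV \<le> p}"
          using k[OF k'(1)] k'(2) by blast
      qed
      show "affine_map c0 e ` lattice_point ` {\<alpha>. sum \<alpha> UNIV \<le> p} \<subseteq> lagrange_nodes p T"
      proof clarify
        fix \<alpha> :: "3 \<Rightarrow> nat" assume \<alpha>: "sum \<alpha> UNIV \<le> p"
        \<comment> \<open>The subtraction on naturals is exact because the total degree of \<alpha>
          is at most p.\<close>
        define k where "k c = (if c = c0 then p - sum \<alpha> UNIV else \<alpha> (b c))" for c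
        have ka: "k (a j) = \<alpha> j" for j by (simp add: k_def ba ac)
        have "sum k C = p" by (simp add: reindex ka) (simp add: k_def \<alpha>)
        with k[OF this] show "affine_map c0 e (lattice_point \<alpha>) \<in> lagrange_nodes p T"
          unfolding nodes ka by auto
      qed
    qed
  qed
  ultimately show ?thesis by (rule that)
qed

lemma finite_lagrange_nodes:
  assumes "3 simplex T" "p \<ge> 1"
  shows "finite (lagrange_nodes p T)"
    and "card (lagrange_nodes p T) \<le> card {\<alpha> :: 3 \<Rightarrow> nat. sum \<alpha> UNIV \<le> p}"
    and "lagrange_nodes p T \<noteq> {}"
    and "lagrange_nodes p T \<subseteq> T"
proof -
  obtain a e where ae: "T = affine_map a e ` corner p"
    "lagrange_nodes p T = affine_map a e ` lattice_point ` {\<alpha>. sum \<alpha> UNIV \<le> p}"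
    using simplex_parametrization[OF assms] .
  show "finite (lagrange_nodes p T)" by (simp add: ae(2))
  show "card (lagrange_nodes p T) \<le> card {\<alpha> :: 3 \<Rightarrow> nat. sum \<alpha> UNIV \<le> p}"
    unfolding ae(2) image_image by (rule card_image_le) simp
  show "lagrange_nodes p T \<noteq> {}" unfolding ae(2) by (auto intro: exI[of _ "\<lambda>_. 0"])
  show "lagrange_nodes p T \<subseteq> T" using lattice_point_in_corner unfolding ae(2) by (auto simp: ae(1))
qed

text \<open>The constant comes from \<open>corner p\<close> and is chosen before T, so it is the
  same for arbitrarily flat tetrahedra.\<close>

lemma polynomial_bound_by_nodes:
  assumes "p \<ge> 1"
  shows "\<exists>K>0. \<forall>T q M. 3 simplex T \<longrightarrow> q \<in> polynomials p \<longrightarrow> (\<forall>z\<in>lagrange_nodes p T. \<bar>q z\<bar> \<le> M) \<longrightarrow>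
    (\<forall>x\<in>T. \<bar>q x\<bar> \<le> K * M)"
proof -
  obtain K where K: "K > 0" and bound: "\<forall>q\<in>newton_span p. \<forall>M.
      (\<forall>\<beta>. sum \<beta> UNIV \<le> p \<longrightarrow> \<bar>q (lattice_point \<beta>)\<bar> \<le> M) \<longrightarrow> (\<forall>x\<in>corner p. \<bar>q x\<bar> \<le> K * M)"
    using newton_span_bound[OF compact_corner, of p p] by blast
  show ?thesis
  proof (intro exI[of _ K] conjI K allI impI ballI)
    fix T q M x
    assume T: "3 simplex T" and q: "q \<in> polynomials p" and M: "\<forall>z\<in>lagrange_nodes p T. \<bar>q z\<bar> \<le> M" and x: "x \<in> T"
    obtain a e where ae: "T = affine_map a e ` corner p"
      "lagrange_nodes p T = affine_map a e ` lattice_point ` {\<alpha>. sum \<alpha> UNIV \<le> p}"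
      using simplex_parametrization[OF T assms] .
    have span: "(\<lambda>t. q (affine_map a e t)) \<in> newton_span p"
      unfolding affine_map_def by (rule polynomials_compose_affine[OF q])
    have "\<forall>\<beta>. sum \<beta> UNIV \<le> p \<longrightarrow> \<bar>q (affine_map a e (lattice_point \<beta>))\<bar> \<le> M"
      using M unfolding ae(2) by auto
    moreover obtain t where "t \<in> corner p" "x = affine_map a e t" using x ae(1) by blast
    ultimately show "\<bar>q x\<bar> \<le> K * M" using bound[rule_format, OF span, of M t] by simp
  qed
qed

text \<open>In reference coordinates the polynomial varies by at most half its largest nodal value
  within a fixed radius of the node. The reference set is bounded, so a contraction towards the node
  by a fixed factor brings all of it within that radius; contractions commute with affine maps, so
  the claim can be stated on T.\<close>

lemma polynomial_large_near_max_node: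
  assumes "p \<ge> 1"
  shows "\<exists>\<epsilon>>0. \<epsilon> \<le> 1 \<and> (\<forall>T q z. 3 simplex T \<longrightarrow> q \<in> polynomials p \<longrightarrow> z \<in> lagrange_nodes p T \<longrightarrow>
    (\<forall>w\<in>lagrange_nodes p T. \<bar>q w\<bar> \<le> \<bar>q z\<bar>) \<longrightarrow> (\<forall>x\<in>T. \<bar>q z\<bar> / 2 \<le> \<bar>q (z + \<epsilon> *\<^sub>R (x - z))\<bar>))"
proof -
  obtain r where r: "r > 0" and modulus: "\<forall>q\<in>newton_span p. \<forall>M.
      (\<forall>\<beta>. sum \<beta> UNIV \<le> p \<longrightarrow> \<bar>q (lattice_point \<beta>)\<bar> \<le> M) \<longrightarrow>
      (\<forall>x\<in>corner p. \<forall>y\<in>corner p. dist x y < r \<longrightarrow> \<bar>q x - q y\<bar> \<le> 1 / 2 * M)"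
    using newton_span_modulus[OF compact_corner, of "1/2" p p] by auto
  obtain B where B: "B > 0" "\<forall>t\<in>corner p. norm t \<le> B"
    using compact_imp_bounded[OF compact_corner[of p]] by (auto simp: bounded_pos)
  \<comment> \<open>Two points of the reference set are at distance at most \<open>2 * B\<close>;
    the 4 leaves r/2, strictly below r. The minimum with 1 makes the contraction a convex
    combination, which stays in the set.\<close>
  define \<epsilon> where "\<epsilon> = min 1 (r / (4 * B))"
  have \<epsilon>: "0 < \<epsilon>" "\<epsilon> \<le> 1" using r B by (auto simp: \<epsilon>_def)
  have \<epsilon>B: "\<epsilon> * (2 * B) < r"
  proof -
    have "\<epsilon> * (2 * B) \<le> r / (4 * B) * (2 * B)" using B by (intro mult_right_mono) (auto simp: \<epsilon>_def)
    also have "\<dots> < r" using r B by simp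
    finally show ?thesis .
  qed
  show ?thesis
  proof (intro exI[of _ \<epsilon>] conjI \<epsilon> allI impI ballI)
    fix T q z x
    assume T: "3 simplex T" and q: "q \<in> polynomials p" and z: "z \<in> lagrange_nodes p T"
      and max: "\<forall>w\<in>lagrange_nodes p T. \<bar>q w\<bar> \<le> \<bar>q z\<bar>" and x: "x \<in> T"
    obtain a e where ae: "T = affine_map a e ` corner p"
      "lagrange_nodes p T = affine_map a e ` lattice_point ` {\<alpha>. sum \<alpha> UNIV \<le> p}"
      using simplex_parametrization[OF T assms] .
    obtain s where s: "s \<in> corner p" "z = affine_map a e s"
      using z lattice_point_in_corner unfolding ae(2) by blast
    obtain t where t: "t \<in> corner p" "x = affine_map a e t" using x ae(1) by blast
    define y where "y = s + \<epsilon> *\<^sub>R (t - s)"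
    have "affine_map a e y = z + \<epsilon> *\<^sub>R (x - z)"
      by (simp add: y_def s t affine_map_def algebra_simps sum.distrib sum_subtractf scaleR_sum_right)
    moreover have "y \<in> corner p"
    proof -
      have y: "y $ i = (1 - \<epsilon>) * s $ i + \<epsilon> * t $ i" for i by (simp add: y_def algebra_simps)
      have "(\<Sum>i\<in>UNIV. y $ i) = (1 - \<epsilon>) * (\<Sum>i\<in>UNIV. s $ i) + \<epsilon> * (\<Sum>i\<in>UNIV. t $ i)"
        by (simp add: y sum.distrib sum_distrib_left)
      also have "\<dots> \<le> (1 - \<epsilon>) * real p + \<epsilon> * real p"
        using s t \<epsilon> by (intro add_mono mult_left_mono) (auto simp: corner_def)
      also have "\<dots> = real p" by (simp add: algebra_simps)
      finally have "(\<Sum>i\<in>UNIV. y $ i) \<le> real p" .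
      moreover have "0 \<le> y $ i" for i
        using s(1) t(1) \<epsilon> unfolding y by (intro add_nonneg_nonneg mult_nonneg_nonneg) (auto simp: corner_def)
      ultimately show ?thesis by (simp add: corner_def)
    qed
    moreover have "dist s y < r"
    proof -
      have "dist s y = \<epsilon> * norm (t - s)" using \<epsilon> by (simp add: y_def dist_norm)
      also have "\<dots> \<le> \<epsilon> * (2 * B)"
      proof -
        have "norm (t - s) \<le> norm t + norm s" by (rule norm_triangle_ineq4)
        also have "\<dots> \<le> 2 * B" using B(2)[rule_format, OF s(1)] B(2)[rule_format, OF t(1)] by linarith
        finally show ?thesis using \<epsilon> by (intro mult_left_mono) auto
      qed
      finally show ?thesis using \<epsilon>B by linarith
    qed
    moreover have span: "(\<lambda>t. q (affine_map a e t)) \<in> newton_span p"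
      unfolding affine_map_def by (rule polynomials_compose_affine[OF q])
    moreover have "\<forall>\<beta>. sum \<beta> UNIV \<le> p \<longrightarrow> \<bar>q (affine_map a e (lattice_point \<beta>))\<bar> \<le> \<bar>q z\<bar>"
      using max unfolding ae(2) by auto
    ultimately have "\<bar>q (affine_map a e s) - q (affine_map a e y)\<bar> \<le> 1 / 2 * \<bar>q z\<bar>"
      using modulus[rule_format, OF span, of "\<bar>q z\<bar>" s y] s(1) by simp
    then have "\<bar>q z - q (z + \<epsilon> *\<^sub>R (x - z))\<bar> \<le> 1 / 2 * \<bar>q z\<bar>"
      by (simp only: s(2)[symmetric] \<open>affine_map a e y = z + \<epsilon> *\<^sub>R (x - z)\<close>)
    then show "\<bar>q z\<bar> / 2 \<le> \<bar>q (z + \<epsilon> *\<^sub>R (x - z))\<bar>" by linarith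
  qed
qed

section \<open>Integrals over the mesh\<close>

lemma simplex_compact_convex:
  fixes T :: "'a :: euclidean_space set"
  assumes "n simplex T"
  shows "compact T" "convex T"
  using assms unfolding simplex_def
  by (auto intro!: finite_imp_compact_convex_hull aff_independent_finite)

lemma set_integrable_continuous_compact:
  fixes f :: "'a::euclidean_space \<Rightarrow> real"
  assumes "compact S" "continuous_on S f"
  shows "set_integrable lebesgue S f"
  unfolding set_integrable_def
  using borel_integrable_compact[OF assms] by (intro integrable_completion[THEN iffD2]) auto

lemma continuous_on_polynomial: "q \<in> polynomials p \<Longrightarrow> continuous_on S q"
  unfolding polynomials_def by (auto simp: fun_eq_iff[symmetric] intro!: continuous_intros)

text \<open>On the contracted copy of T the square is at least a quarter of its maximal nodal value,
  and the copy has the volume of T times \<epsilon>^3; the constant is the quotient of 4 by this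
  factor. All other nodal values are below the maximal one.\<close>

lemma nodal_value_le_integral:
  assumes "p \<ge> 1"
  shows "\<exists>c>0. \<forall>T q z. 3 simplex T \<longrightarrow> q \<in> polynomials p \<longrightarrow> z \<in> lagrange_nodes p T \<longrightarrow>
    measure lebesgue T * (q z)\<^sup>2 \<le> c * (LINT x:T|lebesgue. (q x)\<^sup>2)"
proof -
  obtain \<epsilon> where \<epsilon>: "0 < \<epsilon>" "\<epsilon> \<le> 1" and large: "\<forall>T q z. 3 simplex T \<longrightarrow> q \<in> polynomials p \<longrightarrow>
      z \<in> lagrange_nodes p T \<longrightarrow> (\<forall>w\<in>lagrange_nodes p T. \<bar>q w\<bar> \<le> \<bar>q z\<bar>) \<longrightarrow>
      (\<forall>x\<in>T. \<bar>q z\<bar> / 2 \<le> \<bar>q (z + \<epsilon> *\<^sub>R (x - z))\<bar>)"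
    using polynomial_large_near_max_node[OF assms] by blast
  show ?thesis
  proof (intro exI[of _ "4 / \<epsilon> ^ 3"] conjI allI impI)
    show "4 / \<epsilon> ^ 3 > 0" using \<epsilon> by simp
    fix T q z
    assume T: "3 simplex T" and q: "q \<in> polynomials p" and z: "z \<in> lagrange_nodes p T"
    let ?Z = "lagrange_nodes p T"
    obtain m where m: "m \<in> ?Z" "\<forall>w\<in>?Z. \<bar>q w\<bar> \<le> \<bar>q m\<bar>"
    proof -
      have "Max ((\<lambda>w. \<bar>q w\<bar>) ` ?Z) \<in> (\<lambda>w. \<bar>q w\<bar>) ` ?Z"
        using finite_lagrange_nodes[OF T assms] by (intro Max_in) auto
      then obtain m where "m \<in> ?Z" "\<bar>q m\<bar> = Max ((\<lambda>w. \<bar>q w\<bar>) ` ?Z)" by auto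
      then show ?thesis using finite_lagrange_nodes[OF T assms] by (intro that[of m]) auto
    qed
    have mT: "m \<in> T" using finite_lagrange_nodes(4)[OF T assms] m by blast
    define T' where "T' = (\<lambda>x. m + \<epsilon> *\<^sub>R (x - m)) ` T"
    have cT: "compact T" "convex T" using simplex_compact_convex[OF T] .
    have cT': "compact T'"
      unfolding T'_def by (intro compact_continuous_image continuous_intros cT)
    have "T' \<subseteq> T"
    proof
      fix y assume "y \<in> T'"
      then obtain x where "x \<in> T" "y = (1 - \<epsilon>) *\<^sub>R m + \<epsilon> *\<^sub>R x"
        by (auto simp: T'_def algebra_simps)
      then show "y \<in> T" using convexD[OF cT(2) mT, of x "1 - \<epsilon>" \<epsilon>] \<epsilon> by auto
    qed
    \<comment> \<open>Only the ratio of the homothety in dimension 3 enters, not the Jacobian of the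
      map from the reference set.\<close>
    have meas: "measure lebesgue T' = \<epsilon> ^ 3 * measure lebesgue T"
    proof -
      have "T' = (\<lambda>x. \<epsilon> *\<^sub>R x + (1 - \<epsilon>) *\<^sub>R m) ` T"
        unfolding T'_def by (intro image_cong) (auto simp: algebra_simps)
      then show ?thesis
        using measure_lebesgue_affine[of \<epsilon> "(1 - \<epsilon>) *\<^sub>R m" T] \<epsilon> by (simp add: add.commute power3_eq_cube mult_ac)
    qed
    have int: "set_integrable lebesgue T (\<lambda>x. (q x)\<^sup>2)"
      by (intro set_integrable_continuous_compact cT continuous_intros continuous_on_polynomial[OF q])
    have sq: "(q m)\<^sup>2 / 4 \<le> (q y)\<^sup>2" if "y \<in> T'" for y
    proof -
      have "\<bar>q m\<bar> / 2 \<le> \<bar>q y\<bar>" using that large T q m by (auto simp: T'_def)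
      then have "(\<bar>q m\<bar> / 2)\<^sup>2 \<le> \<bar>q y\<bar>\<^sup>2" by (intro power_mono) auto
      then show ?thesis by (simp add: power_divide)
    qed
    have "\<epsilon> ^ 3 * measure lebesgue T * ((q m)\<^sup>2 / 4) = (LINT x|lebesgue. indicator T' x *\<^sub>R ((q m)\<^sup>2 / 4))"
      using lmeasurable_compact[OF cT'] by (simp add: meas fmeasurable_def)
    also have "\<dots> \<le> (LINT x|lebesgue. indicator T x *\<^sub>R (q x)\<^sup>2)"
    proof (rule integral_mono)
      show "integrable lebesgue (\<lambda>x. indicator T' x *\<^sub>R ((q m)\<^sup>2 / 4))"
        using set_integrable_continuous_compact[OF cT', of "\<lambda>_. (q m)\<^sup>2 / 4"] by (simp add: set_integrable_def)
      show "integrable lebesgue (\<lambda>x. indicator T x *\<^sub>R (q x)\<^sup>2)"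
        using int by (simp add: set_integrable_def)
      show "indicator T' x *\<^sub>R ((q m)\<^sup>2 / 4) \<le> indicator T x *\<^sub>R (q x)\<^sup>2" for x
        using \<open>T' \<subseteq> T\<close> sq[of x] by (auto simp: indicator_def)
    qed
    also have "\<dots> = (LINT x:T|lebesgue. (q x)\<^sup>2)" by (simp add: set_lebesgue_integral_def)
    finally have "measure lebesgue T * (q m)\<^sup>2 \<le> 4 / \<epsilon> ^ 3 * (LINT x:T|lebesgue. (q x)\<^sup>2)"
      using \<epsilon> by (simp add: field_simps)
    moreover have "measure lebesgue T * (q z)\<^sup>2 \<le> measure lebesgue T * (q m)\<^sup>2"
      using m(2) z by (intro mult_left_mono) (auto simp: abs_le_square_iff)
    ultimately show "measure lebesgue T * (q z)\<^sup>2 \<le> 4 / \<epsilon> ^ 3 * (LINT x:T|lebesgue. (q x)\<^sup>2)"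
      by linarith
  qed
qed

lemma integral_le_nodal_values:
  assumes "p \<ge> 1"
  shows "\<exists>c>0. \<forall>T q. 3 simplex T \<longrightarrow> q \<in> polynomials p \<longrightarrow>
    (LINT x:T|lebesgue. (q x)\<^sup>2) \<le> c * measure lebesgue T * (\<Sum>z\<in>lagrange_nodes p T. (q z)\<^sup>2)"
proof -
  obtain K where K: "K > 0" and bound: "\<forall>T q M. 3 simplex T \<longrightarrow> q \<in> polynomials p \<longrightarrow>
      (\<forall>z\<in>lagrange_nodes p T. \<bar>q z\<bar> \<le> M) \<longrightarrow> (\<forall>x\<in>T. \<bar>q x\<bar> \<le> K * M)"
    using polynomial_bound_by_nodes[OF assms] by blast
  show ?thesis
  proof (intro exI[of _ "K\<^sup>2"] conjI allI impI)
    show "K\<^sup>2 > 0" using K by simp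
    fix T :: "pt set" and q
    assume T: "3 simplex T" and q: "q \<in> polynomials p"
    let ?Z = "lagrange_nodes p T"
    \<comment> \<open>The Euclidean norm of the nodal values dominates each of them, and its square
      is the sum in the claim.\<close>
    define M where "M = sqrt (\<Sum>z\<in>?Z. (q z)\<^sup>2)"
    have M2: "M\<^sup>2 = (\<Sum>z\<in>?Z. (q z)\<^sup>2)" by (simp add: M_def sum_nonneg)
    have "\<bar>q z\<bar> \<le> M" if "z \<in> ?Z" for z
    proof -
      have "(q z)\<^sup>2 \<le> (\<Sum>z\<in>?Z. (q z)\<^sup>2)"
        using that finite_lagrange_nodes(1)[OF T assms] by (intro member_le_sum) auto
      then show ?thesis unfolding M_def by (metis real_sqrt_abs real_sqrt_le_iff)
    qed
    then have le: "\<bar>q x\<bar> \<le> K * M" if "x \<in> T" for x using bound T q that by blast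
    have cT: "compact T" using simplex_compact_convex(1)[OF T] .
    have "(LINT x:T|lebesgue. (q x)\<^sup>2) \<le> (LINT x:T|lebesgue. K\<^sup>2 * M\<^sup>2)"
    proof (rule set_integral_mono)
      show "set_integrable lebesgue T (\<lambda>x. (q x)\<^sup>2)"
        by (intro set_integrable_continuous_compact cT continuous_intros continuous_on_polynomial[OF q])
      show "set_integrable lebesgue T (\<lambda>x. K\<^sup>2 * M\<^sup>2)"
        by (intro set_integrable_continuous_compact cT continuous_intros)
      show "(q x)\<^sup>2 \<le> K\<^sup>2 * M\<^sup>2" if "x \<in> T" for x
        using power_mono[OF le[OF that], of 2] by (simp add: power_mult_distrib)
    qed
    also have "\<dots> = K\<^sup>2 * measure lebesgue T * M\<^sup>2"
      using lmeasurable_compact[OF cT] by (simp add: set_lebesgue_integral_def fmeasurable_def)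
    finally show "(LINT x:T|lebesgue. (q x)\<^sup>2) \<le> K\<^sup>2 * measure lebesgue T * (\<Sum>z\<in>?Z. (q z)\<^sup>2)"
      by (simp add: M2)
  qed
qed

section \<open>Volumes of elements and the number of elements at a point\<close>

lemma measure_cball3: "r \<ge> 0 \<Longrightarrow> measure lebesgue (cball (x :: pt) r) = unit_ball_vol 3 * r ^ 3"
  by (simp add: content_cball)

text \<open>The set in \<open>inradius\<close> also contains all negative r, whose balls are empty.
  A one-point ball contributes 0, and the diameter bounds the set, so the supremum is a genuine
  one.\<close>

lemma inradius_nonneg:
  assumes "bounded T" "T \<noteq> {}"
  shows "0 \<le> inradius T"
  unfolding inradius_def
proof (rule cSup_upper)
  obtain x where "x \<in> T" using assms(2) by blast
  then have "cball x 0 \<subseteq> T" by simp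
  then show "0 \<in> {r. \<exists>x. cball x r \<subseteq> T}" by blast
  have "r \<le> diameter T" if r: "cball x r \<subseteq> T" for x :: pt and r
  proof (cases "r \<ge> 0")
    case True
    have "diameter (cball x r) \<le> diameter T" by (intro diameter_subset r assms)
    then show ?thesis using True by simp
  next
    case False
    then show ?thesis using diameter_ge_0[OF assms(1)] by linarith
  qed
  then show "bdd_above {r. \<exists>x. cball x r \<subseteq> T}" by (intro bdd_aboveI) auto
qed

text \<open>An element lies in a ball of radius \<open>c * h\<close> about any of its points and
  contains a ball whose radius is comparable to h. The existence of one element already forces
  \<open>c\<close> and \<open>d\<close> to be positive.\<close>

lemma element_measure_bounds:
  assumes "quasi_uniform c h \<T>" "shape_regular d \<T>" "T \<in> \<T>" "3 simplex T" "h > 0"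
  shows "c > 0" "d > 0" "T \<subseteq> cball x (c * h) \<or> x \<notin> T"
    and "measure lebesgue T \<le> unit_ball_vol 3 * (c * h) ^ 3"
    and "unit_ball_vol 3 * (h / (2 * c * d)) ^ 3 \<le> measure lebesgue T"
proof -
  obtain y where y: "y \<in> T" using assms(4) by (force simp: simplex_def)
  have cT: "compact T" using simplex_compact_convex(1)[OF assms(4)] .
  note bT = compact_imp_bounded[OF cT]
  have D: "0 \<le> diameter T" "diameter T \<le> c * h" "h \<le> c * diameter T" "diameter T \<le> d * inradius T"
    using assms diameter_ge_0[OF bT] by (auto simp: quasi_uniform_def shape_regular_def)
  have "c * diameter T > 0" using D assms(5) by linarith
  then show c: "c > 0" using D(1) by (simp add: zero_less_mult_iff)
  have Dpos: "diameter T > 0" using \<open>c * diameter T > 0\<close> c by (simp add: zero_less_mult_iff)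
  have "d * inradius T > 0" using D Dpos by linarith
  moreover have "0 \<le> inradius T" using inradius_nonneg[OF bT] y by blast
  ultimately show d: "d > 0" by (simp add: zero_less_mult_iff)
  have sub: "T \<subseteq> cball x (c * h)" if "x \<in> T" for x
    using order_trans[OF diameter_bounded_bound[OF bT that] D(2)] by auto
  then show "T \<subseteq> cball x (c * h) \<or> x \<notin> T" by blast
  have "measure lebesgue T \<le> measure lebesgue (cball y (c * h))"
    using sub[OF y] lmeasurable_compact[OF cT] by (intro measure_mono_fmeasurable) auto
  then show "measure lebesgue T \<le> unit_ball_vol 3 * (c * h) ^ 3"
    using c assms(5) measure_cball3[of "c * h" y] by simp
  \<comment> \<open>The hypotheses give the inradius at least h/(c d). The factor 2 buys a strict
    inequality, so that a ball of larger radius can be taken from the set under the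
    supremum.\<close>
  have "h / (2 * c * d) < inradius T"
  proof -
    have "h \<le> c * (d * inradius T)" using D c by (meson mult_left_mono less_imp_le order_trans)
    moreover have "h < 2 * h" using assms(5) by simp
    ultimately have "h < 2 * (c * (d * inradius T))" by linarith
    then show ?thesis using c d by (simp add: field_simps)
  qed
  moreover have "{r. \<exists>x. cball x r \<subseteq> T} \<noteq> {}" by (auto intro: exI[of _ "- 1"])
  ultimately obtain r x where r: "cball x r \<subseteq> T" "h / (2 * c * d) < r"
    unfolding inradius_def by (auto elim: less_cSupE)
  have "unit_ball_vol 3 * (h / (2 * c * d)) ^ 3 \<le> unit_ball_vol 3 * r ^ 3"
    using r(2) c d assms(5) by (intro mult_left_mono power_mono) auto
  also have "\<dots> = measure lebesgue (cball x r)"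
  proof -
    have "0 < h / (2 * c * d)" using c d assms(5) by simp
    then have "0 \<le> r" using r(2) by linarith
    then show ?thesis using measure_cball3[of r x] by simp
  qed
  also have "\<dots> \<le> measure lebesgue T"
    using r(1) lmeasurable_compact[OF cT] by (intro measure_mono_fmeasurable) auto
  finally show "unit_ball_vol 3 * (h / (2 * c * d)) ^ 3 \<le> measure lebesgue T" .
qed

text \<open>The common face of two different elements is a proper face of at least one of them,
  hence part of the frontier of a convex set, which is a null set.\<close>

lemma triangulation_negligible_overlap:
  assumes "triangulation \<T>" "S \<in> \<T>" "T \<in> \<T>" "S \<noteq> T"
  shows "negligible (S \<inter> T)"
proof -
  have proper: "negligible F" if F: "F face_of U" "F \<noteq> U" and U: "U \<in> \<T>" for F U
  proof -
    obtain n where "n simplex U" using assms(1) U by (auto simp: triangulation_def)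
    then have "convex U" by (rule simplex_compact_convex)
    moreover have "F \<inter> interior U = {}" using F by (rule face_of_disjoint_interior)
    then have "F \<subseteq> frontier U"
      using face_of_imp_subset[OF F(1)] closure_subset by (fastforce simp: frontier_def)
    ultimately show ?thesis using negligible_convex_frontier negligible_subset by blast
  qed
  have "S \<inter> T face_of S" "S \<inter> T face_of T"
    using assms unfolding triangulation_def by (blast, metis Int_commute)
  then show ?thesis using proper[of "S \<inter> T" S] proper[of "S \<inter> T" T] assms by blast
qed

text \<open>A packing argument: the elements containing x overlap in null sets only, have volume at
  least that of a ball of radius h/(2cd), and all fit into the ball of radius \<open>c * h\<close>
  about x. The bound is the cube of the ratio of the radii.\<close>

lemma elements_at_point_bound:
  assumes "quasi_uniform c h \<T>" "shape_regular d \<T>" "triangulation \<T>" "\<forall>T\<in>\<T>. 3 simplex T" "h > 0"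
    and "c > 0" "d > 0"
  shows "real (card {T \<in> \<T>. x \<in> T}) \<le> (2 * c\<^sup>2 * d) ^ 3"
proof -
  let ?S = "{T \<in> \<T>. x \<in> T}"
  have fin: "finite ?S" using assms(3) by (simp add: triangulation_def)
  have lm: "T \<in> lmeasurable" if "T \<in> ?S" for T
    using that assms(4) simplex_compact_convex(1) lmeasurable_compact by blast
  have "real (card ?S) * (unit_ball_vol 3 * (h / (2 * c * d)) ^ 3) = (\<Sum>T\<in>?S. unit_ball_vol 3 * (h / (2 * c * d)) ^ 3)"
    by simp
  also have "\<dots> \<le> (\<Sum>T\<in>?S. measure lebesgue T)"
    using element_measure_bounds(5)[OF assms(1,2)] assms by (intro sum_mono) auto
  also have "\<dots> = measure lebesgue (\<Union>?S)"
    using triangulation_negligible_overlap[OF assms(3)] lm fin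
    by (intro measure_negligible_finite_Union[symmetric]) (auto simp: pairwise_def)
  also have "\<dots> \<le> measure lebesgue (cball x (c * h))"
  proof (intro measure_mono_fmeasurable)
    show "\<Union>?S \<subseteq> cball x (c * h)"
      using element_measure_bounds(3)[OF assms(1,2), of _ x] assms by blast
    show "\<Union>?S \<in> sets lebesgue" using lm fin by (auto intro!: sets.finite_Union)
  qed auto
  also have "\<dots> = unit_ball_vol 3 * (c * h) ^ 3"
    using assms by (intro measure_cball3) simp
  finally have "unit_ball_vol 3 * (real (card ?S) * (h / (2 * c * d)) ^ 3) \<le> unit_ball_vol 3 * (c * h) ^ 3"
    by (simp add: mult_ac)
  then have "real (card ?S) * (h / (2 * c * d)) ^ 3 \<le> (c * h) ^ 3"
    by (simp add: mult_le_cancel_left_pos)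
  also have "(c * h) ^ 3 = (2 * c\<^sup>2 * d) ^ 3 * (h / (2 * c * d)) ^ 3"
    using assms by (simp add: power_mult_distrib[symmetric] power2_eq_square)
  finally show ?thesis using assms by (simp add: mult_le_cancel_right_pos)
qed

text \<open>The elements are not disjoint, so the sum goes through \<open>has_integral\<close>,
  whose union rule tolerates negligible overlaps.\<close>

lemma set_integral_triangulation:
  fixes v :: scalar_fun
  assumes "triangulation \<T>" "continuous_on (\<Union>\<T>) v"
  shows "(LINT x:\<Union>\<T>|lebesgue. (v x)\<^sup>2) = (\<Sum>T\<in>\<T>. LINT x:T|lebesgue. (v x)\<^sup>2)"
proof -
  have fin: "finite \<T>" using assms(1) by (simp add: triangulation_def)
  have comp: "compact T" if "T \<in> \<T>" for T
    using that assms(1) simplex_compact_convex(1) unfolding triangulation_def by blast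
  have cont: "continuous_on T (\<lambda>x. (v x)\<^sup>2)" if "T \<subseteq> \<Union>\<T>" for T
    by (intro continuous_intros continuous_on_subset[OF assms(2) that])
  have int: "set_integrable lebesgue T (\<lambda>x. (v x)\<^sup>2)" if "T \<in> \<T>" for T
    using comp[OF that] cont[of T] that by (intro set_integrable_continuous_compact) auto
  have intU: "set_integrable lebesgue (\<Union>\<T>) (\<lambda>x. (v x)\<^sup>2)"
    using comp cont fin by (intro set_integrable_continuous_compact compact_Union) auto
  have "((\<lambda>x. (v x)\<^sup>2) has_integral (\<Sum>T\<in>\<T>. LINT x:T|lebesgue. (v x)\<^sup>2)) (\<Union>\<T>)"
    using triangulation_negligible_overlap[OF assms(1)] has_integral_set_lebesgue[OF int]
    by (intro has_integral_Union fin) (auto simp: pairwise_def)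
  then show ?thesis using has_integral_set_lebesgue[OF intU] has_integral_unique by blast
qed

text \<open>The constants depend on p, \<open>c\<close> and \<open>d\<close> only. The element
  estimates count a node once for each element that has it, the sum in the claim counts it once;
  this multiplicity lies between 1 and a constant.\<close>

lemma nodal_norm_equivalence:
  assumes "p \<ge> 1"
  shows "\<exists>a>0. \<exists>b>0. \<forall>\<T> h v. quasi_uniform c h \<T> \<longrightarrow> shape_regular d \<T> \<longrightarrow> triangulation \<T> \<longrightarrow>
    (\<forall>T\<in>\<T>. 3 simplex T) \<longrightarrow> h > 0 \<longrightarrow> v \<in> fe_space p \<T> \<longrightarrow>
    h ^ 3 * (\<Sum>z\<in>(\<Union>T\<in>\<T>. lagrange_nodes p T). (v z)\<^sup>2) \<le> a * (LINT x:\<Union>\<T>|lebesgue. (v x)\<^sup>2) \<and>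
    (LINT x:\<Union>\<T>|lebesgue. (v x)\<^sup>2) \<le> b * (h ^ 3 * (\<Sum>z\<in>(\<Union>T\<in>\<T>. lagrange_nodes p T). (v z)\<^sup>2))"
proof (cases "c > 0 \<and> d > 0")
  case False
  \<comment> \<open>If \<open>c\<close> or \<open>d\<close> is not positive, the mesh has no
    elements and both sums are zero, so any positive constants will do.\<close>
  have "\<T> = {}" if "quasi_uniform c h \<T>" "shape_regular d \<T>" "\<forall>T\<in>\<T>. 3 simplex T" "h > 0" for \<T> h
    using element_measure_bounds(1,2)[OF that(1,2)] that False by blast
  note empty = this
  have trivial: "h ^ 3 * (\<Sum>z\<in>(\<Union>T\<in>\<T>. lagrange_nodes p T). (v z)\<^sup>2) \<le> 1 * (LINT x:\<Union>\<T>|lebesgue. (v x)\<^sup>2) \<and>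
      (LINT x:\<Union>\<T>|lebesgue. (v x)\<^sup>2) \<le> 1 * (h ^ 3 * (\<Sum>z\<in>(\<Union>T\<in>\<T>. lagrange_nodes p T). (v z)\<^sup>2))"
    if "quasi_uniform c h \<T>" "shape_regular d \<T>" "\<forall>T\<in>\<T>. 3 simplex T" "h > 0" for \<T> h and v :: scalar_fun
    unfolding empty[OF that] by (simp add: set_lebesgue_integral_def)
  show ?thesis
  proof (rule exI[of _ "1::real"], rule conjI)
    show "\<exists>b>0. \<forall>\<T> h v. quasi_uniform c h \<T> \<longrightarrow> shape_regular d \<T> \<longrightarrow> triangulation \<T> \<longrightarrow>
    (\<forall>T\<in>\<T>. 3 simplex T) \<longrightarrow> h > 0 \<longrightarrow> v \<in> fe_space p \<T> \<longrightarrow>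
    h ^ 3 * (\<Sum>z\<in>(\<Union>T\<in>\<T>. lagrange_nodes p T). (v z)\<^sup>2) \<le> 1 * (LINT x:\<Union>\<T>|lebesgue. (v x)\<^sup>2) \<and>
    (LINT x:\<Union>\<T>|lebesgue. (v x)\<^sup>2) \<le> b * (h ^ 3 * (\<Sum>z\<in>(\<Union>T\<in>\<T>. lagrange_nodes p T). (v z)\<^sup>2))"
    proof (rule exI[of _ "1::real"], rule conjI, simp, intro allI impI)
      fix \<T> h and v :: scalar_fun
      assume a: "quasi_uniform c h \<T>" "shape_regular d \<T>" "\<forall>T\<in>\<T>. 3 simplex T" "h > 0"
      show "h ^ 3 * (\<Sum>z\<in>(\<Union>T\<in>\<T>. lagrange_nodes p T). (v z)\<^sup>2) \<le> 1 * (LINT x:\<Union>\<T>|lebesgue. (v x)\<^sup>2) \<and>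
    (LINT x:\<Union>\<T>|lebesgue. (v x)\<^sup>2) \<le> 1 * (h ^ 3 * (\<Sum>z\<in>(\<Union>T\<in>\<T>. lagrange_nodes p T). (v z)\<^sup>2))"
        by (rule trivial[OF a])
    qed
  qed simp
next
  case True
  then have c: "c > 0" and d: "d > 0" by auto
  obtain k where k: "k > 0" and lower: "\<And>T q z. 3 simplex T \<Longrightarrow> q \<in> polynomials p \<Longrightarrow> z \<in> lagrange_nodes p T \<Longrightarrow>
      measure lebesgue T * (q z)\<^sup>2 \<le> k * (LINT x:T|lebesgue. (q x)\<^sup>2)"
    using nodal_value_le_integral[OF assms] by blast
  obtain l where l: "l > 0" and upper: "\<And>T q. 3 simplex T \<Longrightarrow> q \<in> polynomials p \<Longrightarrow>
      (LINT x:T|lebesgue. (q x)\<^sup>2) \<le> l * measure lebesgue T * (\<Sum>z\<in>lagrange_nodes p T. (q z)\<^sup>2)"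
    using integral_le_nodal_values[OF assms] by blast
  define n where "n = real (card {\<alpha> :: 3 \<Rightarrow> nat. sum \<alpha> UNIV \<le> p})"
  have "n > 0"
  proof -
    have "0 < card {\<alpha> :: 3 \<Rightarrow> nat. sum \<alpha> UNIV \<le> p}"
      by (auto simp: card_gt_0_iff intro: exI[of _ "\<lambda>_. 0"])
    then show ?thesis by (simp only: n_def of_nat_0_less_iff)
  qed
  \<comment> \<open>\<open>lo\<close> and \<open>hi\<close> are the bounds for element volumes in
    units of h^3, and \<open>m\<close> bounds the number of elements at a node. Above,
    \<open>n\<close> bounds the number of nodes of an element.\<close>
  define lo where "lo = unit_ball_vol 3 * (1 / (2 * c * d)) ^ 3"
  define hi where "hi = unit_ball_vol 3 * c ^ 3"
  define m where "m = (2 * c\<^sup>2 * d) ^ 3"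
  have pos: "lo > 0" "hi > 0" "m > 0" using c d by (auto simp: lo_def hi_def m_def)
  have main: "h ^ 3 * (\<Sum>z\<in>(\<Union>T\<in>\<T>. lagrange_nodes p T). (v z)\<^sup>2) \<le> n * k / lo * (LINT x:\<Union>\<T>|lebesgue. (v x)\<^sup>2) \<and>
    (LINT x:\<Union>\<T>|lebesgue. (v x)\<^sup>2) \<le> l * hi * m * (h ^ 3 * (\<Sum>z\<in>(\<Union>T\<in>\<T>. lagrange_nodes p T). (v z)\<^sup>2))"
    if qu: "quasi_uniform c h \<T>" and sr: "shape_regular d \<T>" and tri: "triangulation \<T>"
      and simp3: "\<forall>T\<in>\<T>. 3 simplex T" and h: "h > 0" and v: "v \<in> fe_space p \<T>" for \<T> h v
  proof -
    let ?nodes = "lagrange_nodes p"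
    let ?Z = "\<Union>T\<in>\<T>. ?nodes T"
    have finT: "finite \<T>" using tri by (simp add: triangulation_def)
    have finN: "finite (?nodes T)" if "T \<in> \<T>" for T
      using that simp3 finite_lagrange_nodes(1) assms by blast
    then have finZ: "finite ?Z" using finT by blast
    have cont: "continuous_on (\<Union>\<T>) v" using v by (simp add: fe_space_def)
    define I where "I T = (LINT x:T|lebesgue. (v x)\<^sup>2)" for T
    have total: "I (\<Union>\<T>) = (\<Sum>T\<in>\<T>. I T)"
      unfolding I_def by (rule set_integral_triangulation[OF tri cont])
    have vol: "lo * h ^ 3 \<le> measure lebesgue T" "measure lebesgue T \<le> hi * h ^ 3" if "T \<in> \<T>" for T
      using element_measure_bounds(4,5)[OF qu sr that] simp3 that h
      by (auto simp: lo_def hi_def power_mult_distrib power_divide)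
    have loc: "\<exists>q\<in>polynomials p. I T = (LINT x:T|lebesgue. (q x)\<^sup>2) \<and> (\<forall>z\<in>?nodes T. v z = q z)"
      if T: "T \<in> \<T>" for T
    proof -
      obtain q where q: "q \<in> polynomials p" "\<forall>x\<in>T. v x = q x" using v T unfolding fe_space_def by blast
      have "I T = (LINT x:T|lebesgue. (q x)\<^sup>2)"
        unfolding I_def set_lebesgue_integral_def using q(2)
        by (intro Bochner_Integration.integral_cong) (auto simp: indicator_def)
      moreover have "?nodes T \<subseteq> T" using finite_lagrange_nodes(4) simp3 T assms by blast
      ultimately show ?thesis using q by blast
    qed
    have low: "h ^ 3 * (v z)\<^sup>2 \<le> k / lo * I T" if Tz: "T \<in> \<T>" "z \<in> ?nodes T" for T z
    proof -
      obtain q where q: "q \<in> polynomials p" "I T = (LINT x:T|lebesgue. (q x)\<^sup>2)" "v z = q z"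
        using loc Tz by blast
      have "lo * h ^ 3 * (v z)\<^sup>2 \<le> measure lebesgue T * (v z)\<^sup>2"
        using vol(1)[OF Tz(1)] by (intro mult_right_mono) auto
      also have "\<dots> \<le> k * I T" using lower[of T q z] simp3 Tz q by simp
      finally show ?thesis using pos by (simp add: field_simps)
    qed
    have upp: "I T \<le> l * hi * h ^ 3 * (\<Sum>z\<in>?nodes T. (v z)\<^sup>2)" if T: "T \<in> \<T>" for T
    proof -
      obtain q where q: "q \<in> polynomials p" "I T = (LINT x:T|lebesgue. (q x)\<^sup>2)" "\<forall>z\<in>?nodes T. v z = q z"
        using loc T by blast
      have "I T \<le> l * measure lebesgue T * (\<Sum>z\<in>?nodes T. (v z)\<^sup>2)"
        using upper[of T q] simp3 T q by simp
      also have "\<dots> \<le> l * (hi * h ^ 3) * (\<Sum>z\<in>?nodes T. (v z)\<^sup>2)"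
        using vol(2)[OF T] l by (intro mult_right_mono mult_left_mono sum_nonneg) auto
      finally show ?thesis by (simp add: mult_ac)
    qed
    \<comment> \<open>Double counting of the incidences between nodes and elements. The weights on
      the right are at least 1, which gives the first estimate, and at most \<open>m\<close>, which
      gives the second.\<close>
    have count: "(\<Sum>T\<in>\<T>. \<Sum>z\<in>?nodes T. f z) = (\<Sum>z\<in>?Z. real (card {T \<in> \<T>. z \<in> ?nodes T}) * f z)" for f
    proof -
      have "(\<Sum>T\<in>\<T>. \<Sum>z\<in>?nodes T. f z) = (\<Sum>T\<in>\<T>. \<Sum>z | z \<in> ?Z \<and> z \<in> ?nodes T. f z)"
        by (intro sum.cong refl) auto
      also have "\<dots> = (\<Sum>z\<in>?Z. \<Sum>T | T \<in> \<T> \<and> z \<in> ?nodes T. f z)"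
        by (rule sum.swap_restrict[OF finT finZ])
      finally show ?thesis by simp
    qed
    have "h ^ 3 * (\<Sum>z\<in>?Z. (v z)\<^sup>2) = (\<Sum>z\<in>?Z. 1 * (h ^ 3 * (v z)\<^sup>2))"
      by (simp add: sum_distrib_left)
    also have "\<dots> \<le> (\<Sum>z\<in>?Z. real (card {T \<in> \<T>. z \<in> ?nodes T}) * (h ^ 3 * (v z)\<^sup>2))"
    proof (intro sum_mono mult_right_mono)
      fix z assume "z \<in> ?Z"
      then have "{T \<in> \<T>. z \<in> ?nodes T} \<noteq> {}" by blast
      then have "0 < card {T \<in> \<T>. z \<in> ?nodes T}" using finT by (simp add: card_gt_0_iff)
      then show "1 \<le> real (card {T \<in> \<T>. z \<in> ?nodes T})" by linarith
    qed (use h in auto)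
    also have "\<dots> = (\<Sum>T\<in>\<T>. \<Sum>z\<in>?nodes T. h ^ 3 * (v z)\<^sup>2)" by (rule count[symmetric])
    also have "\<dots> \<le> (\<Sum>T\<in>\<T>. \<Sum>z\<in>?nodes T. k / lo * I T)"
      by (intro sum_mono low)
    also have "\<dots> = (\<Sum>T\<in>\<T>. real (card (?nodes T)) * (k / lo * I T))" by simp
    also have "\<dots> \<le> (\<Sum>T\<in>\<T>. n * (k / lo * I T))"
    proof (intro sum_mono mult_right_mono)
      fix T assume T: "T \<in> \<T>"
      show "real (card (?nodes T)) \<le> n"
        unfolding n_def using finite_lagrange_nodes(2)[of T p] simp3 T assms by simp
      have "0 \<le> I T" unfolding I_def set_lebesgue_integral_def by (intro Bochner_Integration.integral_nonneg) auto
      then show "0 \<le> k / lo * I T" using k pos by simp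
    qed
    also have "\<dots> = n * k / lo * I (\<Union>\<T>)"
      unfolding total sum_distrib_left by (intro sum.cong refl) simp
    finally have 1: "h ^ 3 * (\<Sum>z\<in>?Z. (v z)\<^sup>2) \<le> n * k / lo * I (\<Union>\<T>)" .
    have "I (\<Union>\<T>) \<le> (\<Sum>T\<in>\<T>. l * hi * h ^ 3 * (\<Sum>z\<in>?nodes T. (v z)\<^sup>2))"
      unfolding total by (intro sum_mono upp)
    also have "\<dots> = l * hi * h ^ 3 * (\<Sum>T\<in>\<T>. \<Sum>z\<in>?nodes T. (v z)\<^sup>2)"
      by (simp add: sum_distrib_left)
    also have "(\<Sum>T\<in>\<T>. \<Sum>z\<in>?nodes T. (v z)\<^sup>2) \<le> (\<Sum>z\<in>?Z. m * (v z)\<^sup>2)"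
      unfolding count
    proof (intro sum_mono mult_right_mono)
      fix z
      have "{T \<in> \<T>. z \<in> ?nodes T} \<subseteq> {T \<in> \<T>. z \<in> T}"
        using finite_lagrange_nodes(4) simp3 assms by blast
      then have "card {T \<in> \<T>. z \<in> ?nodes T} \<le> card {T \<in> \<T>. z \<in> T}"
        using finT by (intro card_mono) auto
      then show "real (card {T \<in> \<T>. z \<in> ?nodes T}) \<le> m"
        using elements_at_point_bound[OF qu sr tri simp3 h c d, of z] unfolding m_def by linarith
    qed auto
    then have "l * hi * h ^ 3 * (\<Sum>T\<in>\<T>. \<Sum>z\<in>?nodes T. (v z)\<^sup>2) \<le> l * hi * h ^ 3 * (\<Sum>z\<in>?Z. m * (v z)\<^sup>2)"
      using l pos h by (intro mult_left_mono) auto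
    finally have "I (\<Union>\<T>) \<le> l * hi * m * (h ^ 3 * (\<Sum>z\<in>?Z. (v z)\<^sup>2))"
      by (simp add: sum_distrib_left[symmetric] mult_ac)
    with 1 show ?thesis unfolding I_def by blast
  qed
  have "n * k / lo > 0" "l * hi * m > 0" using \<open>n > 0\<close> k l pos by auto
  then show ?thesis using main by blast
qed

section \<open>Finiteness of the surface measure\<close>

text \<open>Finiteness of the two-dimensional Hausdorff outer measure, witnessed by finite families:
  \<open>C\<close> is chosen before \<delta>, so refining the cover does not increase the bound, and
  all sums stay in the reals.\<close>

definition finite_area_covers :: "pt set \<Rightarrow> bool" where
  "finite_area_covers A \<longleftrightarrow> (\<exists>C. \<forall>\<delta>>0. \<exists>F. finite F \<and> A \<subseteq> \<Union>F \<and>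
     (\<forall>E\<in>F. bounded E \<and> diameter E \<le> \<delta>) \<and> (\<Sum>E\<in>F. (diameter E)\<^sup>2) \<le> C)"

lemma finite_area_covers_subset:
  assumes "finite_area_covers B" "A \<subseteq> B"
  shows "finite_area_covers A"
proof -
  obtain C where C: "\<forall>\<delta>>0. \<exists>F. finite F \<and> B \<subseteq> \<Union>F \<and>
     (\<forall>E\<in>F. bounded E \<and> diameter E \<le> \<delta>) \<and> (\<Sum>E\<in>F. (diameter E)\<^sup>2) \<le> C"
    using assms(1) unfolding finite_area_covers_def by blast
  show ?thesis
    unfolding finite_area_covers_def
  proof (intro exI[of _ C] allI impI)
    fix \<delta> :: real assume \<delta>: "\<delta> > 0"
    obtain F where F: "finite F" "B \<subseteq> \<Union>F" "\<forall>E\<in>F. bounded E \<and> diameter E \<le> \<delta>"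
      "(\<Sum>E\<in>F. (diameter E)\<^sup>2) \<le> C"
      using C[rule_format, OF \<delta>] by (elim exE conjE)
    show "\<exists>F. finite F \<and> A \<subseteq> \<Union>F \<and> (\<forall>E\<in>F. bounded E \<and> diameter E \<le> \<delta>) \<and>
        (\<Sum>E\<in>F. (diameter E)\<^sup>2) \<le> C"
      by (intro exI[of _ F] conjI subset_trans[OF assms(2)] F)
  qed
qed

lemma finite_area_covers_Un:
  assumes "finite_area_covers A" "finite_area_covers B"
  shows "finite_area_covers (A \<union> B)"
proof -
  obtain C where C: "\<And>\<delta>. \<delta> > 0 \<Longrightarrow> \<exists>F. finite F \<and> A \<subseteq> \<Union>F \<and>
     (\<forall>E\<in>F. bounded E \<and> diameter E \<le> \<delta>) \<and> (\<Sum>E\<in>F. (diameter E)\<^sup>2) \<le> C"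
    using assms(1) unfolding finite_area_covers_def by blast
  obtain C' where C': "\<And>\<delta>. \<delta> > 0 \<Longrightarrow> \<exists>F. finite F \<and> B \<subseteq> \<Union>F \<and>
     (\<forall>E\<in>F. bounded E \<and> diameter E \<le> \<delta>) \<and> (\<Sum>E\<in>F. (diameter E)\<^sup>2) \<le> C'"
    using assms(2) unfolding finite_area_covers_def by blast
  show ?thesis
    unfolding finite_area_covers_def
  proof (intro exI[of _ "C + C'"] allI impI)
    fix \<delta> :: real assume "\<delta> > 0"
    obtain F where F: "finite F" "A \<subseteq> \<Union>F" "\<forall>E\<in>F. bounded E \<and> diameter E \<le> \<delta>" "(\<Sum>E\<in>F. (diameter E)\<^sup>2) \<le> C"
      using C[OF \<open>\<delta> > 0\<close>] by blast
    obtain G where G: "finite G" "B \<subseteq> \<Union>G" "\<forall>E\<in>G. bounded E \<and> diameter E \<le> \<delta>" "(\<Sum>E\<in>G. (diameter E)\<^sup>2) \<le> C'"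
      using C'[OF \<open>\<delta> > 0\<close>] by blast
    have "(\<Sum>E\<in>F \<union> G. (diameter E)\<^sup>2) \<le> (\<Sum>E\<in>F. (diameter E)\<^sup>2) + (\<Sum>E\<in>G. (diameter E)\<^sup>2)"
      using sum.union_inter[OF F(1) G(1), of "\<lambda>E. (diameter E)\<^sup>2"] sum_nonneg[of "F \<inter> G" "\<lambda>E. (diameter E)\<^sup>2"]
      by simp
    then show "\<exists>H. finite H \<and> A \<union> B \<subseteq> \<Union>H \<and> (\<forall>E\<in>H. bounded E \<and> diameter E \<le> \<delta>) \<and>
        (\<Sum>E\<in>H. (diameter E)\<^sup>2) \<le> C + C'"
      using F G by (intro exI[of _ "F \<union> G"]) auto
  qed
qed

lemma finite_area_covers_empty: "finite_area_covers {}"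
  unfolding finite_area_covers_def by (intro exI[of _ 0] allI impI exI[of _ "{}"]) auto

lemma finite_area_covers_UN:
  "finite I \<Longrightarrow> (\<And>i. i \<in> I \<Longrightarrow> finite_area_covers (A i)) \<Longrightarrow> finite_area_covers (\<Union>i\<in>I. A i)"
proof (induction I rule: finite_induct)
  case (insert i I)
  then have "finite_area_covers (A i \<union> (\<Union>i\<in>I. A i))"
    by (intro finite_area_covers_Un) blast+
  then show ?case by simp
qed (simp add: finite_area_covers_empty)

lemma hausdorff2_outer_finite:
  assumes "finite_area_covers A"
  shows "hausdorff2_outer A < \<infinity>"
proof -
  obtain C where C: "\<And>\<delta>. \<delta> > 0 \<Longrightarrow> \<exists>F. finite F \<and> A \<subseteq> \<Union>F \<and>
     (\<forall>E\<in>F. bounded E \<and> diameter E \<le> \<delta>) \<and> (\<Sum>E\<in>F. (diameter E)\<^sup>2) \<le> C"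
    using assms unfolding finite_area_covers_def by blast
  have "hausdorff2_outer A \<le> ennreal (pi / 4 * C)"
    unfolding hausdorff2_outer_def
  proof (rule SUP_least)
    fix \<delta> :: real assume "\<delta> \<in> {0<..}"
    then obtain F where F: "finite F" "A \<subseteq> \<Union>F" "\<forall>E\<in>F. bounded E \<and> diameter E \<le> \<delta>" "(\<Sum>E\<in>F. (diameter E)\<^sup>2) \<le> C"
      using C by (metis greaterThan_iff)
    obtain e :: "nat \<Rightarrow> pt set" where e: "bij_betw e {..<card F} F"
      using F(1) by (metis ex_bij_betw_nat_finite atLeast0LessThan)
    \<comment> \<open>The outer measure asks for a sequence, so the family is continued by empty
      sets, which have diameter 0.\<close>
    define E where "E i = (if i < card F then e i else {})" for i
    have "A \<subseteq> (\<Union>i. E i)"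
    proof
      fix x assume "x \<in> A"
      then obtain B where "B \<in> F" "x \<in> B" using F by blast
      then have "B \<in> e ` {..<card F}" using bij_betw_imp_surj_on[OF e] by simp
      then obtain i where "i < card F" "B = e i" by blast
      with \<open>x \<in> B\<close> have "x \<in> E i" by (simp add: E_def)
      then show "x \<in> (\<Union>i. E i)" by blast
    qed
    moreover have "bounded (E i) \<and> diameter (E i) \<le> \<delta>" for i
      using F e \<open>\<delta> \<in> {0<..}\<close> by (auto simp: E_def bij_betw_def)
    ultimately have "(INF E\<in>{E. A \<subseteq> (\<Union>i. E i) \<and> (\<forall>i. bounded (E i) \<and> diameter (E i) \<le> \<delta>)}.
        (\<Sum>i. ennreal (pi / 4 * (diameter (E i))\<^sup>2))) \<le> (\<Sum>i. ennreal (pi / 4 * (diameter (E i))\<^sup>2))"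
      by (intro INF_lower) auto
    also have "\<dots> = (\<Sum>i<card F. ennreal (pi / 4 * (diameter (E i))\<^sup>2))"
      by (intro suminf_finite) (auto simp: E_def)
    also have "\<dots> = ennreal (\<Sum>i<card F. pi / 4 * (diameter (E i))\<^sup>2)"
      by (intro sum_ennreal) auto
    also have "(\<Sum>i<card F. pi / 4 * (diameter (E i))\<^sup>2) = pi / 4 * (\<Sum>B\<in>F. (diameter B)\<^sup>2)"
      unfolding sum_distrib_left[symmetric]
      using sum.reindex_bij_betw[OF e, of "\<lambda>B. (diameter B)\<^sup>2"] by (simp add: E_def)
    also have "ennreal (pi / 4 * (\<Sum>B\<in>F. (diameter B)\<^sup>2)) \<le> ennreal (pi / 4 * C)"
      using F(4) by (intro ennreal_leI mult_left_mono) auto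
    finally show "(INF E\<in>{E. A \<subseteq> (\<Union>i. E i) \<and> (\<forall>i. bounded (E i) \<and> diameter (E i) \<le> \<delta>)}.
        (\<Sum>i. ennreal (pi / 4 * (diameter (E i))\<^sup>2))) \<le> ennreal (pi / 4 * C)" .
  qed
  then show ?thesis by (simp add: le_less_trans)
qed

text \<open>A square of side s is cut into n^2 cells of side s/n. Points of one cell are at distance
  at most 2s/n (one s/n per coordinate), so the image of a cell has diameter at most 2Ls/n, and n^2
  times its square does not depend on n.\<close>

lemma finite_area_covers_lipschitz_image:
  fixes f :: "real ^ 2 \<Rightarrow> pt"
  assumes "L > 0" "s > 0" and lip: "\<And>y z. y \<in> Q \<Longrightarrow> z \<in> Q \<Longrightarrow> dist (f y) (f z) \<le> L * dist y z"
    and Q: "Q \<subseteq> {y. \<forall>i. a $ i \<le> y $ i \<and> y $ i < a $ i + s}"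
  shows "finite_area_covers (f ` Q)"
  unfolding finite_area_covers_def
proof (intro exI[of _ "(2 * L * s)\<^sup>2"] allI impI)
  fix \<delta> :: real assume "\<delta> > 0"
  obtain n :: nat where n: "n > 0" "2 * L * s / \<delta> < real n"
    using reals_Archimedean2[of "2 * L * s / \<delta>"] assms \<open>\<delta> > 0\<close>
    by (metis divide_pos_pos gr0I mult_pos_pos not_less_iff_gr_or_eq of_nat_0 zero_less_numeral)
  \<comment> \<open>Cells are the level sets of the rounded-down coordinates. As the square is
    half-open, the indices run exactly through 0 to n - 1.\<close>
  define cell where "cell k = {y \<in> Q. \<forall>i. \<lfloor>real n * (y $ i - a $ i) / s\<rfloor> = k i}" for k :: "2 \<Rightarrow> int"
  define K where "K = (UNIV :: 2 set) \<rightarrow>\<^sub>E {0..<int n}"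
  have finK: "finite K" unfolding K_def by (intro finite_PiE) auto
  have cardK: "card K = n\<^sup>2" unfolding K_def by (simp add: card_PiE)
  have diam: "bounded (f ` cell k) \<and> diameter (f ` cell k) \<le> 2 * L * s / real n" for k
  proof -
    have "dist y z \<le> 2 * s / real n" if y: "y \<in> cell k" and z: "z \<in> cell k" for y z
    proof -
      have "\<bar>(y - z) $ i\<bar> \<le> s / real n" for i
      proof -
        have "\<lfloor>real n * (y $ i - a $ i) / s\<rfloor> = \<lfloor>real n * (z $ i - a $ i) / s\<rfloor>"
          using y z by (simp add: cell_def)
        then have "\<bar>real n * (y $ i - a $ i) / s - real n * (z $ i - a $ i) / s\<bar> < 1"
          by linarith
        also have "real n * (y $ i - a $ i) / s - real n * (z $ i - a $ i) / s = real n * (y - z) $ i / s"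
          by (simp add: diff_divide_distrib[symmetric] right_diff_distrib)
        also have "\<bar>\<dots>\<bar> = real n * \<bar>(y - z) $ i\<bar> / s"
          using n assms by (simp only: abs_mult abs_divide abs_of_pos of_nat_0_less_iff)
        finally have "real n * \<bar>(y - z) $ i\<bar> < s" using assms by (simp only: pos_divide_less_eq mult_1)
        then show ?thesis using n by (simp add: pos_le_divide_eq mult.commute del: vector_minus_component)
      qed
      then have "(\<Sum>i\<in>UNIV. \<bar>(y - z) $ i\<bar>) \<le> (\<Sum>i\<in>(UNIV :: 2 set). s / real n)" by (intro sum_mono)
      then show ?thesis unfolding dist_norm using norm_le_l1_cart[of "y - z"] by simp
    qed
    note cell_diam = this
    have D: "dist x x' \<le> 2 * L * s / real n" if x: "x \<in> f ` cell k" and x': "x' \<in> f ` cell k" for x x'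
    proof -
      obtain y where y: "y \<in> cell k" "x = f y" using x by (rule imageE)
      obtain z where z: "z \<in> cell k" "x' = f z" using x' by (rule imageE)
      have "dist x x' \<le> L * dist y z" using lip y z by (simp add: cell_def)
      also have "\<dots> \<le> L * (2 * s / real n)"
        using cell_diam[OF y(1) z(1)] assms(1) by (intro mult_left_mono) auto
      finally show ?thesis by (simp add: mult_ac)
    qed
    have "bounded (f ` cell k)" unfolding bounded_two_points using D by blast
    moreover have "diameter (f ` cell k) \<le> 2 * L * s / real n"
      using D assms n by (intro diameter_le) (auto simp: dist_norm)
    ultimately show ?thesis by blast
  qed
  have small: "2 * L * s / real n \<le> \<delta>" using n \<open>\<delta> > 0\<close> by (simp add: field_simps)
  show "\<exists>F. finite F \<and> f ` Q \<subseteq> \<Union>F \<and> (\<forall>E\<in>F. bounded E \<and> diameter E \<le> \<delta>) \<and> (\<Sum>E\<in>F. (diameter E)\<^sup>2) \<le> (2 * L * s)\<^sup>2"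
  proof (intro exI[of _ "(\<lambda>k. f ` cell k) ` K"] conjI)
    show "finite ((\<lambda>k. f ` cell k) ` K)" using finK by simp
    show "f ` Q \<subseteq> \<Union>((\<lambda>k. f ` cell k) ` K)"
    proof (rule image_subsetI)
      fix y assume y: "y \<in> Q"
      define k where "k = (\<lambda>i. \<lfloor>real n * (y $ i - a $ i) / s\<rfloor>)"
      have "k \<in> K"
        unfolding K_def
      proof (rule PiE_I)
        fix i
        have d: "0 \<le> y $ i - a $ i" "y $ i - a $ i < s"
          using subsetD[OF Q y] by (auto simp: algebra_simps)
        have "real n * (y $ i - a $ i) < real n * s"
          using d(2) n(1) by (intro mult_strict_left_mono) auto
        then have "real n * (y $ i - a $ i) / s < real n"
          using assms(2) by (simp only: pos_divide_less_eq)
        moreover have "0 \<le> real n * (y $ i - a $ i) / s"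
          using d(1) assms(2) by (intro divide_nonneg_pos mult_nonneg_nonneg) auto
        ultimately show "k i \<in> {0..<int n}" unfolding k_def by (auto simp: floor_less_iff)
      qed auto
      moreover have "y \<in> cell k" using y by (simp add: cell_def k_def)
      ultimately show "f y \<in> \<Union>((\<lambda>k. f ` cell k) ` K)" by blast
    qed
    show "\<forall>E\<in>(\<lambda>k. f ` cell k) ` K. bounded E \<and> diameter E \<le> \<delta>" 
    proof (rule ballI)
      fix E assume "E \<in> (\<lambda>k. f ` cell k) ` K"
      then obtain k where "E = f ` cell k" by blast
      then show "bounded E \<and> diameter E \<le> \<delta>" using diam[of k] small by auto
    qed
    \<comment> \<open>Different indices may give the same image, for instance the empty one; as a
      set of sets these collapse, hence only an inequality.\<close>
    have "(\<Sum>E\<in>(\<lambda>k. f ` cell k) ` K. (diameter E)\<^sup>2) \<le> (\<Sum>k\<in>K. (diameter (f ` cell k))\<^sup>2)"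
      using sum_image_le[OF finK, of "\<lambda>E. (diameter E)\<^sup>2" "\<lambda>k. f ` cell k"] by (simp add: o_def)
    also have "\<dots> \<le> (\<Sum>k\<in>K. (2 * L * s / real n)\<^sup>2)"
      using diam by (intro sum_mono power_mono diameter_ge_0) auto
    also have "\<dots> = (2 * L * s)\<^sup>2" using n by (simp add: cardK power_divide)
    finally show "(\<Sum>E\<in>(\<lambda>k. f ` cell k) ` K. (diameter E)\<^sup>2) \<le> (2 * L * s)\<^sup>2" .
  qed
qed

text \<open>A chart is cut down to a ball, which fits into a square of side 2r. The image of the
  ball is still open in the surface because the inverse of the chart is Lipschitz, and by
  compactness finitely many such images suffice.\<close>

lemma finite_area_covers_closed_surface:
  assumes "closed_surface \<Gamma>"
  shows "finite_area_covers \<Gamma>"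
proof -
  have "\<exists>U. openin (top_of_set \<Gamma>) U \<and> x \<in> U \<and> finite_area_covers U" if x: "x \<in> \<Gamma>" for x
  proof -
    have "\<exists>V f. surface_chart \<Gamma> V f \<and> x \<in> f ` V"
      using assms x by (simp add: closed_surface_def)
    then obtain V f where chart: "surface_chart \<Gamma> V f" and "x \<in> f ` V" by (elim exE conjE)
    then obtain y where y: "y \<in> V" "f y = x" by auto
    from chart obtain L where L: "L > 0" and V: "open V" "openin (top_of_set \<Gamma>) (f ` V)" and
      bilip: "\<And>u w. u \<in> V \<Longrightarrow> w \<in> V \<Longrightarrow> dist u w \<le> L * dist (f u) (f w) \<and> dist (f u) (f w) \<le> L * dist u w"
      unfolding surface_chart_def by blast
    obtain r where r: "r > 0" "ball y r \<subseteq> V" using V(1) y(1) by (auto simp: open_contains_ball)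
    have "openin (top_of_set (f ` V)) (f ` ball y r)"
      unfolding openin_euclidean_subtopology_iff
    proof (intro conjI ballI)
      show "f ` ball y r \<subseteq> f ` V" using r by blast
      fix z assume "z \<in> f ` ball y r"
      then obtain u where u: "u \<in> ball y r" "z = f u" by blast
      have "r - dist y u > 0" using u by simp
      show "\<exists>e>0. \<forall>x'\<in>f ` V. dist x' z < e \<longrightarrow> x' \<in> f ` ball y r"
      proof (intro exI conjI ballI impI)
        \<comment> \<open>By the lower Lipschitz bound, image points this close come from parameters
          closer to u than the distance left to the boundary of the ball.\<close>
        show "(r - dist y u) / L > 0" using \<open>r - dist y u > 0\<close> L by simp
        fix x' assume "x' \<in> f ` V" "dist x' z < (r - dist y u) / L"
        then obtain w where w: "w \<in> V" "x' = f w" by blast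
        have "dist w u \<le> L * dist (f w) (f u)" using bilip w u r by blast
        also have "\<dots> < r - dist y u"
          using \<open>dist x' z < (r - dist y u) / L\<close> L by (simp add: w u field_simps)
        finally have "dist y w < r" using dist_triangle[of y w u] by (simp add: dist_commute)
        then show "x' \<in> f ` ball y r" using w by simp
      qed
    qed
    then have "openin (top_of_set \<Gamma>) (f ` ball y r)" using V(2) openin_trans by blast
    moreover have "x \<in> f ` ball y r" using y r by auto
    moreover have "finite_area_covers (f ` ball y r)"
    proof (rule finite_area_covers_lipschitz_image[OF L, of "2 * r" _ _ "\<chi> i. y $ i - r"])
      show "dist (f u) (f w) \<le> L * dist u w" if "u \<in> ball y r" "w \<in> ball y r" for u w
        using bilip[of u w] r(2) that by blast
      show "ball y r \<subseteq> {w. \<forall>i. (\<chi> i. y $ i - r) $ i \<le> w $ i \<and> w $ i < (\<chi> i. y $ i - r) $ i + 2 * r}"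
      proof clarify
        fix w i assume "w \<in> ball y r"
        then have "\<bar>(y - w) $ i\<bar> < r" using component_le_norm_cart[of "y - w" i] by (simp add: dist_norm)
        then show "(\<chi> i. y $ i - r) $ i \<le> w $ i \<and> w $ i < (\<chi> i. y $ i - r) $ i + 2 * r" by auto
      qed
    qed (use r in simp)
    ultimately show ?thesis by blast
  qed
  then obtain U where U: "\<And>x. x \<in> \<Gamma> \<Longrightarrow> openin (top_of_set \<Gamma>) (U x)" "\<And>x. x \<in> \<Gamma> \<Longrightarrow> x \<in> U x"
    "\<And>x. x \<in> \<Gamma> \<Longrightarrow> finite_area_covers (U x)"
    by metis
  obtain W where W: "\<And>x. x \<in> \<Gamma> \<Longrightarrow> open (W x) \<and> U x = \<Gamma> \<inter> W x"
    using U(1) unfolding openin_open by metis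
  have cpt: "compact \<Gamma>" using assms by (simp add: closed_surface_def)
  have op: "open (W x)" if "x \<in> \<Gamma>" for x using W[OF that] by blast
  have cov: "\<Gamma> \<subseteq> (\<Union>x\<in>\<Gamma>. W x)"
  proof
    fix x assume "x \<in> \<Gamma>"
    with U(2)[OF this] W[OF this] show "x \<in> (\<Union>x\<in>\<Gamma>. W x)" by blast
  qed
  obtain I where I: "I \<subseteq> \<Gamma>" "finite I" "\<Gamma> \<subseteq> (\<Union>x\<in>I. W x)"
    by (rule compactE_image[OF cpt op cov])
  have "finite_area_covers (\<Union>x\<in>I. U x)" using I U(3) by (intro finite_area_covers_UN) auto
  moreover have "\<Gamma> \<subseteq> (\<Union>x\<in>I. U x)"
  proof
    fix x assume "x \<in> \<Gamma>"
    moreover obtain i where "i \<in> I" "x \<in> W i" using I(3) \<open>x \<in> \<Gamma>\<close> by blast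
    ultimately show "x \<in> (\<Union>x\<in>I. U x)" using W[of i] I(1) by blast
  qed
  ultimately show ?thesis by (rule finite_area_covers_subset)
qed

text \<open>No proof that \<^const>\<open>hausdorff2_outer\<close> is countably additive on the Borel sets is needed:
  if it were not, \<^const>\<open>measure_of\<close> would return the zero measure.\<close>

lemma emeasure_surface_measure_le: "emeasure surface_measure A \<le> hausdorff2_outer A"
  unfolding surface_measure_def by (subst emeasure_measure_of_conv) simp

lemma sets_surface_measure [simp]: "sets surface_measure = sets borel"
  unfolding surface_measure_def
  using sets.sigma_sets_eq[of "borel :: pt measure"] by (subst sets_measure_of) auto

lemma continuous_on_closed_surface_integrable:
  fixes f :: scalar_fun
  assumes "closed_surface \<Gamma>" "continuous_on \<Gamma> f"
  shows "set_integrable surface_measure \<Gamma> f"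
proof -
  have cpt: "compact \<Gamma>" using assms(1) by (simp add: closed_surface_def)
  then have sets: "\<Gamma> \<in> sets surface_measure" by (simp add: borel_compact)
  have fin: "emeasure surface_measure \<Gamma> < \<infinity>"
    using emeasure_surface_measure_le hausdorff2_outer_finite[OF finite_area_covers_closed_surface[OF assms(1)]]
    by (rule le_less_trans)
  obtain B where B: "\<And>x. x \<in> \<Gamma> \<Longrightarrow> norm (f x) \<le> B"
    using compact_imp_bounded[OF compact_continuous_image[OF assms(2) cpt]] by (auto simp: bounded_iff)
  have "(\<lambda>x. indicator \<Gamma> x *\<^sub>R f x) \<in> borel_measurable borel"
    using borel_measurable_continuous_on_indicator[OF _ assms(2)] cpt by (simp add: borel_compact)
  then have meas: "(\<lambda>x. indicator \<Gamma> x *\<^sub>R f x) \<in> borel_measurable surface_measure"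
    by (simp cong: measurable_cong_sets)
  show ?thesis
    unfolding set_integrable_def
  proof (rule Bochner_Integration.integrable_bound[OF _ meas])
    show "integrable surface_measure (\<lambda>x. indicator \<Gamma> x *\<^sub>R B)"
      using sets fin by (intro integrable_scaleR_left integrable_real_indicator) auto
    show "AE x in surface_measure. norm (indicator \<Gamma> x *\<^sub>R f x) \<le> norm (indicator \<Gamma> x *\<^sub>R B)"
      using B by (intro AE_I2) (auto simp: indicator_def intro: order_trans[OF B[unfolded real_norm_def] abs_ge_self])
  qed
qed

section \<open>Coefficient vectors and discrete functions\<close>

lemma polynomials_linear_combination:
  assumes "\<And>i. i \<in> I \<Longrightarrow> q i \<in> polynomials p"
  shows "(\<lambda>x. \<Sum>i\<in>I. c i * q i x) \<in> polynomials p"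
proof -
  have "\<exists>d. \<forall>i\<in>I. \<forall>x. q i x = (\<Sum>\<alpha> | sum \<alpha> UNIV \<le> p. d i \<alpha> * (\<Prod>j\<in>UNIV. (x $ j) ^ \<alpha> j))"
    using assms unfolding polynomials_def by (intro bchoice) blast
  then obtain d where d: "\<forall>i\<in>I. \<forall>x. q i x = (\<Sum>\<alpha> | sum \<alpha> UNIV \<le> p. d i \<alpha> * (\<Prod>j\<in>UNIV. (x $ j) ^ \<alpha> j))"
    by (elim exE)
  show ?thesis
    unfolding polynomials_def
  proof (intro CollectI exI allI)
    fix x
    have "(\<Sum>i\<in>I. c i * q i x) = (\<Sum>i\<in>I. \<Sum>\<alpha> | sum \<alpha> UNIV \<le> p. c i * d i \<alpha> * (\<Prod>j\<in>UNIV. (x $ j) ^ \<alpha> j))"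
      using d by (intro sum.cong) (simp_all add: sum_distrib_left mult.assoc)
    also have "\<dots> = (\<Sum>\<alpha> | sum \<alpha> UNIV \<le> p. \<Sum>i\<in>I. c i * d i \<alpha> * (\<Prod>j\<in>UNIV. (x $ j) ^ \<alpha> j))"
      by (rule sum.swap)
    also have "\<dots> = (\<Sum>\<alpha> | sum \<alpha> UNIV \<le> p. (\<Sum>i\<in>I. c i * d i \<alpha>) * (\<Prod>j\<in>UNIV. (x $ j) ^ \<alpha> j))"
      by (simp add: sum_distrib_right)
    finally show "(\<Sum>i\<in>I. c i * q i x) = (\<Sum>\<alpha> | sum \<alpha> UNIV \<le> p. (\<Sum>i\<in>I. c i * d i \<alpha>) * (\<Prod>j\<in>UNIV. (x $ j) ^ \<alpha> j))" .
  qed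
qed

lemma fe_space_linear_combination:
  assumes "\<And>i. i \<in> I \<Longrightarrow> v i \<in> fe_space p \<T>"
  shows "(\<lambda>x. \<Sum>i\<in>I. c i * v i x) \<in> fe_space p \<T>"
  unfolding fe_space_def
proof (intro CollectI conjI ballI)
  show "continuous_on (\<Union>\<T>) (\<lambda>x. \<Sum>i\<in>I. c i * v i x)"
    using assms by (intro continuous_intros) (simp add: fe_space_def)
  fix T assume T: "T \<in> \<T>"
  have "\<exists>q. \<forall>i\<in>I. q i \<in> polynomials p \<and> (\<forall>x\<in>T. v i x = q i x)"
  proof (intro bchoice ballI)
    fix i assume "i \<in> I"
    then have "v i \<in> fe_space p \<T>" by (rule assms)
    then show "\<exists>q. q \<in> polynomials p \<and> (\<forall>x\<in>T. v i x = q x)"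
      using T by (auto simp: fe_space_def)
  qed
  then obtain q where q: "\<forall>i\<in>I. q i \<in> polynomials p \<and> (\<forall>x\<in>T. v i x = q i x)" by (elim exE)
  show "\<exists>q\<in>polynomials p. \<forall>x\<in>T. (\<Sum>i\<in>I. c i * v i x) = q x"
  proof (rule bexI[of _ "\<lambda>x. \<Sum>i\<in>I. c i * q i x"])
    show "\<forall>x\<in>T. (\<Sum>i\<in>I. c i * v i x) = (\<Sum>i\<in>I. c i * q i x)" using q by simp
    show "(\<lambda>x. \<Sum>i\<in>I. c i * q i x) \<in> polynomials p"
      using q by (intro polynomials_linear_combination) simp
  qed
qed

lemma active_fe_space_linear_combination:
  assumes "\<And>i. i \<in> I \<Longrightarrow> v i \<in> active_fe_space p D"
  shows "(\<lambda>x. \<Sum>i\<in>I. c i * v i x) \<in> active_fe_space p D"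
proof -
  have "\<exists>w. \<forall>i\<in>I. w i \<in> fe_space p (bgmesh D) \<and> v i = (\<lambda>x. if x \<in> active_domain D then w i x else 0)"
  proof (intro bchoice ballI)
    fix i assume "i \<in> I"
    then show "\<exists>w. w \<in> fe_space p (bgmesh D) \<and> v i = (\<lambda>x. if x \<in> active_domain D then w x else 0)"
      using assms[of i] by (auto simp: active_fe_space_def)
  qed
  then obtain w where w: "\<forall>i\<in>I. w i \<in> fe_space p (bgmesh D) \<and> v i = (\<lambda>x. if x \<in> active_domain D then w i x else 0)"
    by (elim exE)
  have "(\<lambda>x. \<Sum>i\<in>I. c i * v i x) = (\<lambda>x. if x \<in> active_domain D then \<Sum>i\<in>I. c i * w i x else 0)"
    using w by (auto simp: fun_eq_iff)
  moreover have "(\<lambda>x. \<Sum>i\<in>I. c i * w i x) \<in> fe_space p (bgmesh D)"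
    using w by (intro fe_space_linear_combination) simp
  ultimately show ?thesis
    unfolding active_fe_space_def by (rule image_eqI)
qed

text \<open>Lets the norm equivalence be applied with the cut elements as the whole mesh; the
  extension by zero is invisible on their union.\<close>

lemma active_fe_space_subset: "active_fe_space p D \<subseteq> fe_space p (active_mesh D)"
proof
  fix v assume "v \<in> active_fe_space p D"
  then obtain w where w: "w \<in> fe_space p (bgmesh D)" "v = (\<lambda>x. if x \<in> active_domain D then w x else 0)"
    by (auto simp: active_fe_space_def)
  have sub: "\<Union>(active_mesh D) \<subseteq> \<Union>(bgmesh D)" by (auto simp: active_mesh_def)
  have eq: "v x = w x" if "x \<in> \<Union>(active_mesh D)" for x
    using that unfolding w(2) active_domain_def by simp
  have "continuous_on (\<Union>(active_mesh D)) w"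
    using w(1) by (intro continuous_on_subset[OF _ sub]) (simp add: fe_space_def)
  then have "continuous_on (\<Union>(active_mesh D)) v"
    by (rule continuous_on_eq) (rule eq[symmetric])
  moreover have "\<exists>q\<in>polynomials p. \<forall>x\<in>T. v x = q x" if T: "T \<in> active_mesh D" for T
  proof -
    have "T \<in> bgmesh D" using T by (simp add: active_mesh_def)
    then obtain q where q: "q \<in> polynomials p" "\<forall>x\<in>T. w x = q x" using w(1) unfolding fe_space_def by blast
    have "v x = w x" if "x \<in> T" for x using eq T that by blast
    then show ?thesis using q by (intro bexI[of _ q]) auto
  qed
  ultimately show "v \<in> fe_space p (active_mesh D)" by (simp add: fe_space_def)
qed

text \<open>Ensures that the extension by zero produces no jump on the surface: discrete functions
  are continuous there and hence integrable.\<close>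

lemma surface_subset_active_domain:
  assumes "tetrahedral_partition \<Omega> (bgmesh D)" "dsurface D \<subseteq> \<Omega>"
  shows "dsurface D \<subseteq> active_domain D"
proof
  fix x assume x: "x \<in> dsurface D"
  have cl: "\<Union>(bgmesh D) = closure \<Omega>" using assms(1) by (simp add: tetrahedral_partition_def)
  have "x \<in> closure \<Omega>" by (rule subsetD[OF closure_subset subsetD[OF assms(2) x]])
  then have "x \<in> \<Union>(bgmesh D)" unfolding cl .
  then show "x \<in> active_domain D" using x by (auto simp: active_domain_def active_mesh_def)
qed

lemma active_fe_space_surface_integrable:
  assumes "tetrahedral_partition \<Omega> (bgmesh D)" "dsurface D \<subseteq> \<Omega>" "closed_surface (dsurface D)"
    and "v \<in> active_fe_space p D"
  shows "set_integrable surface_measure (dsurface D) v"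
proof (rule continuous_on_closed_surface_integrable[OF assms(3)])
  have "continuous_on (active_domain D) v"
    using subsetD[OF active_fe_space_subset assms(4)] by (simp add: fe_space_def active_domain_def)
  then show "continuous_on (dsurface D) v"
    by (rule continuous_on_subset[OF _ surface_subset_active_domain[OF assms(1,2)]])
qed

text \<open>\<open>coeff_space\<close> restricts the coefficients by the integrals of the single
  basis functions. To pass to the integral of the sum, each of them must be integrable, since a
  Bochner integral that does not exist is 0 by convention.\<close>

lemma fe_function_in_Vh:
  assumes "tetrahedral_partition \<Omega> (bgmesh D)" "dsurface D \<subseteq> \<Omega>" "closed_surface (dsurface D)"
    and "nodal_basis p D N \<phi>" "u \<in> coeff_space D N \<phi>"
  shows "fe_function N \<phi> u \<in> Vh p D"
proof -
  have \<phi>: "\<phi> i \<in> active_fe_space p D" if "i \<in> {..<N}" for i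
    using assms(4) that by (auto simp: nodal_basis_def)
  have int: "integrable surface_measure (\<lambda>x. indicator (dsurface D) x *\<^sub>R \<phi> i x)" if "i \<in> {..<N}" for i
    using active_fe_space_surface_integrable[OF assms(1-3) \<phi>[OF that]] by (simp add: set_integrable_def)
  have "fe_function N \<phi> u \<in> active_fe_space p D"
    unfolding fe_function_def by (rule active_fe_space_linear_combination[OF \<phi>])
  moreover have "surface_integral D (fe_function N \<phi> u) = 0"
  proof -
    have "surface_integral D (fe_function N \<phi> u)
        = (LINT x|surface_measure. (\<Sum>i<N. vec_index u i * (indicator (dsurface D) x *\<^sub>R \<phi> i x)))"
      unfolding surface_integral_def set_lebesgue_integral_def fe_function_def
      by (simp add: sum_distrib_left mult.left_commute)
    also have "\<dots> = (\<Sum>i<N. (LINT x|surface_measure. vec_index u i * (indicator (dsurface D) x *\<^sub>R \<phi> i x)))"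
      using int by (intro Bochner_Integration.integral_sum integrable_mult_right) auto
    also have "\<dots> = (\<Sum>i<N. vec_index u i * surface_integral D (\<phi> i))"
      unfolding surface_integral_def set_lebesgue_integral_def by simp
    also have "\<dots> = 0" using assms(5) by (simp add: coeff_space_def)
    finally show ?thesis .
  qed
  ultimately show ?thesis by (simp add: Vh_def)
qed

text \<open>The coefficients are the nodal values, and the enumeration meets a node shared by
  several elements only once. So the nodal sum in the norm equivalence is the squared Euclidean
  norm.\<close>

lemma fe_function_nodal_sum:
  assumes "nodal_basis p D N \<phi>" "u \<in> carrier_vec N"
  shows "(\<Sum>z\<in>(\<Union>T\<in>active_mesh D. lagrange_nodes p T). (fe_function N \<phi> u z)\<^sup>2) = scalar_prod u u"
proof -
  obtain z where z: "bij_betw z {..<N} (\<Union>T\<in>active_mesh D. lagrange_nodes p T)"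
    and \<phi>: "\<And>i j. i < N \<Longrightarrow> j < N \<Longrightarrow> \<phi> i (z j) = (if i = j then 1 else 0)"
    using assms(1) by (auto simp: nodal_basis_def)
  have val: "fe_function N \<phi> u (z j) = vec_index u j" if "j < N" for j
  proof -
    have "fe_function N \<phi> u (z j) = (\<Sum>i<N. if i = j then vec_index u i else 0)"
      unfolding fe_function_def using \<phi>[OF _ that] by (intro sum.cong) auto
    then show ?thesis using that by simp
  qed
  have "(\<Sum>z\<in>(\<Union>T\<in>active_mesh D. lagrange_nodes p T). (fe_function N \<phi> u z)\<^sup>2) = (\<Sum>j<N. (fe_function N \<phi> u (z j))\<^sup>2)"
    by (rule sum.reindex_bij_betw[OF z, symmetric])
  also have "\<dots> = (\<Sum>j<N. vec_index u j * vec_index u j)"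
    by (intro sum.cong) (auto simp: val power2_eq_square)
  also have "\<dots> = scalar_prod u u"
    using assms(2) by (simp add: scalar_prod_def atLeast0LessThan)
  finally show ?thesis .
qed

lemma scalar_prod_self_pos:
  fixes u :: "real Matrix.vec"
  assumes "u \<in> carrier_vec N" "u \<noteq> 0\<^sub>v N"
  shows "scalar_prod u u > 0"
proof -
  have "\<exists>i<N. vec_index u i \<noteq> 0"
  proof (rule ccontr)
    assume "\<not> (\<exists>i<N. vec_index u i \<noteq> 0)"
    then have "u = 0\<^sub>v N" using assms(1) by (intro eq_vecI) auto
    then show False using assms(2) by simp
  qed
  then obtain i where i: "i < N" "vec_index u i \<noteq> 0" by blast
  have "0 < (\<Sum>j\<in>{0..<N}. vec_index u j * vec_index u j)"
    using i by (intro sum_pos2[of _ i]) (auto simp: zero_less_mult_iff)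
  then show ?thesis using assms(1) by (simp add: scalar_prod_def)
qed

text \<open>Adds the zero function as the Sobolev part. It gives access to the positivity of the
  stabilization, which is stated on the sum space.\<close>

lemma Vh_subset_Vh_plus_H: "Vh p D \<subseteq> Vh_plus_H p D"
proof
  fix v assume "v \<in> Vh p D"
  moreover have "(\<lambda>_. 0) \<in> sobolev (p + 1) (interior (active_domain D))"
    unfolding sobolev_def
  proof (intro CollectI conjI allI impI)
    have sq: "square_integrable U (\<lambda>_. 0)" for U
      by (simp add: square_integrable_def set_borel_measurable_def set_integrable_def)
    then show "square_integrable (interior (active_domain D)) (\<lambda>_. 0)" .
    fix js
    have "weak_deriv (interior (active_domain D)) js (\<lambda>_. 0) (\<lambda>_. 0)"
      by (simp add: weak_deriv_def locally_integrable_def set_integrable_def set_lebesgue_integral_def)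
    then show "\<exists>g. square_integrable (interior (active_domain D)) g \<and>
        weak_deriv (interior (active_domain D)) js (\<lambda>_. 0) g"
      by (intro exI[of _ "\<lambda>_. 0"] conjI sq)
  qed
  ultimately show "v \<in> Vh_plus_H p D"
    unfolding Vh_plus_H_def by (intro CollectI exI[of _ v] exI[of _ "\<lambda>_. 0"] conjI) simp_all
qed

text \<open>\<open>sqrt\<close> is also defined for negative reals, where squaring it returns the
  absolute value, so the sign of both summands has to be known first.\<close>

lemma energy_norm_squared:
  assumes "stabilization_form p D" "v \<in> Vh p D"
  shows "(energy_norm D v)\<^sup>2 = A_form D v v" "0 \<le> energy_norm D v"
proof -
  have "0 \<le> a_form D v v"
    unfolding a_form_def surface_integral_def set_lebesgue_integral_def
    by (intro Bochner_Integration.integral_nonneg) (auto simp: indicator_def)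
  moreover have "0 \<le> stab D v v"
  proof -
    have "\<forall>u\<in>Vh_plus_H p D. 0 \<le> stab D u u"
      using assms(1) unfolding stabilization_form_def by (elim conjE)
    then show ?thesis using subsetD[OF Vh_subset_Vh_plus_H assms(2)] by (rule bspec)
  qed
  ultimately show "(energy_norm D v)\<^sup>2 = A_form D v v" "0 \<le> energy_norm D v"
    by (simp_all add: energy_norm_def A_form_def)
qed

lemma L2_norm_active_squared: "(L2_norm_active D v)\<^sup>2 = (LINT x:active_domain D|lebesgue. (v x)\<^sup>2)"
  and L2_norm_active_nonneg: "0 \<le> L2_norm_active D v"
proof -
  have "0 \<le> (LINT x:active_domain D|lebesgue. (v x)\<^sup>2)"
    unfolding set_lebesgue_integral_def by (intro Bochner_Integration.integral_nonneg) (auto simp: indicator_def)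
  then show "(L2_norm_active D v)\<^sup>2 = (LINT x:active_domain D|lebesgue. (v x)\<^sup>2)" "0 \<le> L2_norm_active D v"
    by (simp_all add: L2_norm_active_def)
qed

text \<open>On empty or infinite sets \<^const>\<open>Max\<close> and \<^const>\<open>Min\<close> return the same junk value; this
  covers the coefficient space \<open>{0}\<close>, which has no eigenvalues.\<close>

lemma Max_div_Min_le:
  fixes S :: "real set"
  assumes "\<And>\<mu>. \<mu> \<in> S \<Longrightarrow> m \<le> \<mu> \<and> \<mu> \<le> M" "m > 0" "M / m \<le> r" "1 \<le> r"
  shows "Max S / Min S \<le> r"
proof (cases "finite S \<and> S \<noteq> {}")
  case True
  then have "Min S \<in> S" "Max S \<in> S" by auto
  from assms(1)[OF this(1)] assms(1)[OF this(2)] have "m \<le> Min S" "Max S \<le> M" "0 < Max S"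
    using assms(2) by linarith+
  then have "Max S / Min S \<le> M / m"
    using assms(2) by (intro frac_le) auto
  then show ?thesis using assms(3) by linarith
next
  case False
  \<comment> \<open>The common value is unspecified; its quotient by itself is 1, or 0 should the
    value be 0. This is the case for which \<open>1 \<le> r\<close> is assumed.\<close>
  have "Max S = the None" "Min S = the None"
    using False by (auto simp: Max.infinite Min.infinite Max.eq_fold' Min.eq_fold')
  then have "Max S / Min S \<le> 1" by simp
  then show ?thesis using assms(4) by linarith
qed

text \<open>The powers of h balance as follows: the squared inverse inequality brings h^(-3), which
  cancels the h^3 of the norm equivalence, while the squared Poincare inequality brings h, which
  leaves h^2 of it.\<close>

lemma eigenvalue_bounds:
  assumes "p \<ge> 1" and fam: "discretization_family \<Omega> p h0 \<D>"
    and inverse_inequality: "\<exists>C. \<forall>D\<in>\<D>. \<forall>v\<in>Vh p D.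
           energy_norm D v \<le> C * (meshsize D powr (- 3 / 2) * L2_norm_active D v)"
    and poincare: "\<exists>C. \<forall>D\<in>\<D>. \<forall>v\<in>Vh p D.
           L2_norm_active D v \<le> C * (meshsize D powr (1 / 2) * energy_norm D v)"
  shows "\<exists>m>0. \<exists>M>0. \<forall>D\<in>\<D>. \<forall>N \<phi> \<A>. nodal_basis p D N \<phi> \<longrightarrow> stiffness_operator D N \<phi> \<A> \<longrightarrow>
           (\<forall>\<mu>\<in>eigenvalues_on N (coeff_space D N \<phi>) \<A>. m * (meshsize D)\<^sup>2 \<le> \<mu> \<and> \<mu> \<le> M)"
proof -
  obtain Ci where Ci: "\<And>D v. D \<in> \<D> \<Longrightarrow> v \<in> Vh p D \<Longrightarrow>
      energy_norm D v \<le> Ci * (meshsize D powr (- 3 / 2) * L2_norm_active D v)"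
    using inverse_inequality by meson
  obtain Cp where Cp: "\<And>D v. D \<in> \<D> \<Longrightarrow> v \<in> Vh p D \<Longrightarrow>
      L2_norm_active D v \<le> Cp * (meshsize D powr (1 / 2) * energy_norm D v)"
    using poincare by meson
  have "\<exists>c. \<forall>D\<in>\<D>. quasi_uniform c (meshsize D) (bgmesh D)" "\<exists>d. \<forall>D\<in>\<D>. shape_regular d (bgmesh D)"
    using fam by (simp_all add: discretization_family_def)
  then obtain c d where c: "\<forall>D\<in>\<D>. quasi_uniform c (meshsize D) (bgmesh D)"
    and d: "\<forall>D\<in>\<D>. shape_regular d (bgmesh D)"
    by (elim exE)
  have mem: "0 < meshsize D \<and> meshsize D \<le> h0 \<and> tetrahedral_partition \<Omega> (bgmesh D) \<and>
        closed_surface (dsurface D) \<and> dsurface D \<subseteq> \<Omega> \<and>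
        unit_normal_field (dsurface D) (dnormal D) \<and> stabilization_form p D" if D: "D \<in> \<D>" for D
    using fam unfolding discretization_family_def by (elim conjE) (erule bspec[OF _ D])
  obtain a b where a: "a > 0" and b: "b > 0" and equiv: "\<forall>\<T> h v. quasi_uniform c h \<T> \<longrightarrow>
      shape_regular d \<T> \<longrightarrow> triangulation \<T> \<longrightarrow> (\<forall>T\<in>\<T>. 3 simplex T) \<longrightarrow> h > 0 \<longrightarrow> v \<in> fe_space p \<T> \<longrightarrow>
    h ^ 3 * (\<Sum>z\<in>(\<Union>T\<in>\<T>. lagrange_nodes p T). (v z)\<^sup>2) \<le> a * (LINT x:\<Union>\<T>|lebesgue. (v x)\<^sup>2) \<and>
    (LINT x:\<Union>\<T>|lebesgue. (v x)\<^sup>2) \<le> b * (h ^ 3 * (\<Sum>z\<in>(\<Union>T\<in>\<T>. lagrange_nodes p T). (v z)\<^sup>2))"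
    using nodal_norm_equivalence[OF assms(1), of c d] by (elim exE conjE)
  \<comment> \<open>The given constants may be zero or negative; adding 1 to their squares makes
    both bounds positive.\<close>
  have main: "1 / (a * (Cp\<^sup>2 + 1)) * (meshsize D)\<^sup>2 \<le> \<mu> \<and> \<mu> \<le> (Ci\<^sup>2 + 1) * b"
    if D: "D \<in> \<D>" and nb: "nodal_basis p D N \<phi>" and st: "stiffness_operator D N \<phi> \<A>"
      and \<mu>: "\<mu> \<in> eigenvalues_on N (coeff_space D N \<phi>) \<A>" for D N \<phi> \<A> \<mu>
  proof -
    define h where "h = meshsize D"
    note m = mem[OF D]
    have h: "h > 0" using m by (simp add: h_def)
    from m have tet: "tetrahedral_partition \<Omega> (bgmesh D)" and cs: "closed_surface (dsurface D)"
      and sub: "dsurface D \<subseteq> \<Omega>" and stab: "stabilization_form p D" by auto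
    obtain u where u: "u \<in> coeff_space D N \<phi>" "u \<noteq> 0\<^sub>v N" "\<A> u = \<mu> \<cdot>\<^sub>v u"
      using \<mu> by (auto simp: eigenvalues_on_def)
    have carr: "u \<in> carrier_vec N" using u(1) by (simp add: coeff_space_def)
    define v where "v = fe_function N \<phi> u"
    have v: "v \<in> Vh p D" unfolding v_def by (rule fe_function_in_Vh[OF tet sub cs nb u(1)])
    define n where "n = scalar_prod u u"
    have n: "n > 0" unfolding n_def by (rule scalar_prod_self_pos[OF carr u(2)])
    define E where "E = energy_norm D v"
    define L where "L = L2_norm_active D v"
    have E0: "0 \<le> E" unfolding E_def by (rule energy_norm_squared(2)[OF stab v])
    have L0: "0 \<le> L" unfolding L_def by (rule L2_norm_active_nonneg)
    \<comment> \<open>The identity defining the operator is tested with the eigenvector in both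
      arguments.\<close>
    have rayleigh: "\<mu> * n = E\<^sup>2"
    proof -
      have "\<mu> * n = scalar_prod (\<A> u) u" using carr by (simp add: u(3) n_def)
      also have "\<dots> = A_form D v v" using st u(1) by (simp add: stiffness_operator_def v_def)
      finally show ?thesis using energy_norm_squared(1)[OF stab v] by (simp add: E_def)
    qed
    have sub_mesh: "active_mesh D \<subseteq> bgmesh D" by (auto simp: active_mesh_def)
    have "triangulation (active_mesh D)" "\<forall>T\<in>active_mesh D. 3 simplex T"
      using tet by (auto simp: tetrahedral_partition_def triangulation_def active_mesh_def)
    moreover have "quasi_uniform c h (active_mesh D)" "shape_regular d (active_mesh D)"
      using c[rule_format, OF D] d[rule_format, OF D] sub_mesh by (auto simp: quasi_uniform_def shape_regular_def h_def)
    moreover have "v \<in> fe_space p (active_mesh D)"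
      using v active_fe_space_subset by (auto simp: Vh_def)
    ultimately have eq: "h ^ 3 * n \<le> a * L\<^sup>2" "L\<^sup>2 \<le> b * (h ^ 3 * n)"
      using equiv[rule_format, of h "active_mesh D" v] h fe_function_nodal_sum[OF nb carr]
      by (simp_all add: L_def L2_norm_active_squared n_def v_def active_domain_def)
    have "E \<le> Ci * (h powr (- 3 / 2) * L)" using Ci[OF D v] by (simp add: E_def L_def h_def)
    then have "E\<^sup>2 \<le> (Ci * (h powr (- 3 / 2) * L))\<^sup>2" using E0 by (intro power_mono)
    also have "\<dots> = Ci\<^sup>2 * (L\<^sup>2 / h ^ 3)"
    proof -
      have "(h powr (- 3 / 2))\<^sup>2 = h powr (- 3)" by (simp add: power2_eq_square flip: powr_add)
      also have "\<dots> = 1 / h ^ 3" using h by (simp add: powr_minus powr_numeral divide_inverse)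
      finally show ?thesis by (simp add: power_mult_distrib)
    qed
    also have "\<dots> \<le> Ci\<^sup>2 * (b * n)"
      using eq(2) h by (intro mult_left_mono) (auto simp: field_simps)
    also have "\<dots> \<le> (Ci\<^sup>2 + 1) * (b * n)" using b n by (intro mult_right_mono) auto
    finally have "\<mu> * n \<le> (Ci\<^sup>2 + 1) * b * n" using rayleigh by (simp add: mult.assoc)
    then have 1: "\<mu> \<le> (Ci\<^sup>2 + 1) * b" using n by (simp only: mult_le_cancel_right_pos)
    have "L \<le> Cp * (h powr (1 / 2) * E)" using Cp[OF D v] by (simp add: E_def L_def h_def)
    then have "L\<^sup>2 \<le> (Cp * (h powr (1 / 2) * E))\<^sup>2" using L0 by (intro power_mono)
    also have "\<dots> = Cp\<^sup>2 * (h * E\<^sup>2)"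
    proof -
      have "(h powr (1 / 2))\<^sup>2 = h" using h by (simp add: power2_eq_square flip: powr_add)
      then show ?thesis by (simp add: power_mult_distrib)
    qed
    also have "\<dots> \<le> (Cp\<^sup>2 + 1) * (h * E\<^sup>2)" using h by (intro mult_right_mono) auto
    finally have "a * L\<^sup>2 \<le> a * ((Cp\<^sup>2 + 1) * (h * E\<^sup>2))" using a by (intro mult_left_mono) auto
    with eq(1) have "h ^ 3 * n \<le> a * ((Cp\<^sup>2 + 1) * (h * (\<mu> * n)))" using rayleigh by simp
    \<comment> \<open>Regrouped so that the positive factor \<open>h * n\<close> can be cancelled,
      one h having come from the Poincare inequality.\<close>
    then have "(h * n) * h\<^sup>2 \<le> (h * n) * (a * (Cp\<^sup>2 + 1) * \<mu>)"
      by (simp add: power2_eq_square power3_eq_cube mult_ac)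
    then have "h\<^sup>2 \<le> a * (Cp\<^sup>2 + 1) * \<mu>" using h n by (simp only: mult_le_cancel_left_pos mult_pos_pos)
    moreover have "a * (Cp\<^sup>2 + 1) > 0" using a by (simp add: add_nonneg_pos)
    ultimately have 2: "1 / (a * (Cp\<^sup>2 + 1)) * h\<^sup>2 \<le> \<mu>"
      by (simp add: pos_divide_le_eq mult.commute)
    show ?thesis using 1 2 by (simp add: h_def)
  qed
  have pos: "1 / (a * (Cp\<^sup>2 + 1)) > 0" "(Ci\<^sup>2 + 1) * b > 0" using a b by (auto simp: add_nonneg_pos)
  show ?thesis
    by (rule exI[of _ "1 / (a * (Cp\<^sup>2 + 1))"], rule conjI[OF pos(1)], rule exI[of _ "(Ci\<^sup>2 + 1) * b"],
        rule conjI[OF pos(2)]) (use main in simp)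
qed

theorem theorem6p1:
  fixes \<Omega> :: "(real ^ 3) set" and p :: nat and h0 :: real and \<D> :: "discretization set"
  assumes "polyhedral_domain \<Omega>" and "p \<ge> 1" and "h0 > 0"
    and "discretization_family \<Omega> p h0 \<D>"
    and continuity: "\<exists>C. \<forall>D\<in>\<D>. \<forall>w\<in>Vh_plus_H p D. \<forall>v\<in>Vh_plus_H p D.
           A_form D w v \<le> C * (energy_norm D w * energy_norm D v)"
    and coercivity: "\<exists>C. \<forall>D\<in>\<D>. \<forall>v\<in>Vh p D. (energy_norm D v)\<^sup>2 \<le> C * A_form D v v"
    and inverse_inequality: "\<exists>C. \<forall>D\<in>\<D>. \<forall>v\<in>Vh p D.
           energy_norm D v \<le> C * (meshsize D powr (- 3 / 2) * L2_norm_active D v)"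
    and poincare: "\<exists>C. \<forall>D\<in>\<D>. \<forall>v\<in>Vh p D.
           L2_norm_active D v \<le> C * (meshsize D powr (1 / 2) * energy_norm D v)"
  shows "\<exists>C. \<forall>D\<in>\<D>. \<forall>N \<phi> \<A>.
           nodal_basis p D N \<phi> \<longrightarrow> stiffness_operator D N \<phi> \<A> \<longrightarrow>
           spectral_condition_number N (coeff_space D N \<phi>) \<A> \<le> C * meshsize D powr (- 2)"
proof -
  obtain m M where m: "m > 0" and M: "M > 0" and bounds: "\<forall>D\<in>\<D>. \<forall>N \<phi> \<A>.
      nodal_basis p D N \<phi> \<longrightarrow> stiffness_operator D N \<phi> \<A> \<longrightarrow>
      (\<forall>\<mu>\<in>eigenvalues_on N (coeff_space D N \<phi>) \<A>. m * (meshsize D)\<^sup>2 \<le> \<mu> \<and> \<mu> \<le> M)"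
    using eigenvalue_bounds[OF assms(2,4) inverse_inequality poincare] by (elim exE conjE)
  \<comment> \<open>M/m is the quotient of the eigenvalue bounds up to h^2. The summand
    \<open>h0\<^sup>2\<close> makes the right-hand side at least 1, as h is at most h0; this covers
    a coefficient space without eigenvalues.\<close>
  have "spectral_condition_number N (coeff_space D N \<phi>) \<A> \<le> (M / m + h0\<^sup>2) * meshsize D powr (- 2)"
    if D: "D \<in> \<D>" and nb: "nodal_basis p D N \<phi>" and st: "stiffness_operator D N \<phi> \<A>" for D N \<phi> \<A>
  proof -
    define h where "h = meshsize D"
    have h: "0 < h" "h \<le> h0"
      using assms(4) D by (auto simp: discretization_family_def h_def)
    have pw: "h powr (- 2) = 1 / h\<^sup>2" using h by (simp add: powr_minus powr_numeral divide_inverse)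
    show ?thesis
      unfolding spectral_condition_number_def h_def[symmetric] pw
    proof (rule Max_div_Min_le)
      show "m * h\<^sup>2 \<le> \<mu> \<and> \<mu> \<le> M" if "\<mu> \<in> eigenvalues_on N (coeff_space D N \<phi>) \<A>" for \<mu>
        unfolding h_def by (rule bounds[rule_format, OF D nb st that])
      show "m * h\<^sup>2 > 0" using m h by simp
      show "M / (m * h\<^sup>2) \<le> (M / m + h0\<^sup>2) * (1 / h\<^sup>2)"
        using h by (simp add: add_divide_distrib)
      have "h\<^sup>2 \<le> h0\<^sup>2" using h by (intro power_mono) auto
      then have "h\<^sup>2 \<le> M / m + h0\<^sup>2" using m M by (simp add: add_increasing)
      then show "1 \<le> (M / m + h0\<^sup>2) * (1 / h\<^sup>2)" using h by (simp add: pos_le_divide_eq)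
    qed
  qed
  then show ?thesis by (intro exI[of _ "M / m + h0\<^sup>2"] ballI allI impI)
qed

end
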